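(* For $n\ge1$ and $a\in\{1,2,3\}$, $$\dim_k\left(\frac{R}{I_{S_a}^{[\mathbf{n}]}}\right) = |\mathrm{PF}_n^a| = \frac{(n+1)!}{2}.$$
   Context: $k$ is a field, $R=k[x_1,\ldots,x_n]$. $S_1 = \mathfrak{S}_n(123,132,312)$, $S_2=\mathfrak{S}_n(123,213,231)$, $S_3=\mathfrak{S}_n(132,213,231)$: sets of permutations of $[n]$ (one-line notation) containing no subsequence in the same relative order as any listed pattern. $I_S = \langle\prod_i x_i^{\sigma(i)}:\sigma\in S\rangle$; $I^{[\mathbf{n}]}$ is its Alexander dual with respect to $\mathbf{n}=(n,\ldots,n)$: $I^{[\mathbf{n}]} = \bigcap_{\mathbf{x}^{\mathbf{b}}}\langle x_i^{n+1-b_i} : b_i\ge1\rangle$ over minimal generators $\mathbf{x}^{\mathbf{b}}$ of $I$. A parking function of length $n$ is $\mathbf{p}=(p_1,\ldots,p_n)\in\mathbb{N}^n$ whose nondecreasing rearrangement $p_{i_1}\le\cdots\le p_{i_n}$ satisfies $p_{i_j}<j$ for all $j$; $\mathrm{PF}_n$ is the set of these. $\mathrm{PF}_n^1 = \{\mathbf{p}\in\mathrm{PF}_n : p_t\le t \ \forall t, \text{ and if } p_i=i \text{ then } p_j=0 \text{ for some } j\in[i,n]\}$; $\mathrm{PF}_n^2=\{\mathbf{p}\in\mathrm{PF}_n : \text{if } p_i\ge i \text{ then } p_j<j-1 \text{ for all } j\in[i+1,n]\}$; $\mathrm{PF}_n^3 = \{\mathbf{p}\in\mathrm{PF}_n :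 \text{if } p_i\ge i \text{ then } p_j<n-(j-i)\text{ for all } j\in[i+1,n]\}$. Here $[a,b]=\{m\in\mathbb{Z}: a\le m\le b\}$. *)

theory Defs
  imports
    "HOL-Algebra.Embedded_Algebras"
    "HOL-Algebra.QuotRing"
    "HOL-Library.Poly_Mapping"
    "HOL-Combinatorics.Permutations"
begin

text \<open>
  Exponent vectors are finitely supported functions on variable indices, and the coefficient
  field is the type \<open>'k\<close>. The variables $x_1,\dots,x_n$ carry the indices
  \<open>1, \<dots>, n\<close>.
\<close>

type_synonym 'k mpoly = "(nat \<Rightarrow>\<^sub>0 nat) \<Rightarrow>\<^sub>0 'k"

definition poly_ring :: "nat \<Rightarrow> 'k::field mpoly ring" where
  "poly_ring n =
     \<lparr>carrier = {p. \<forall>m \<in> Poly_Mapping.keys p. Poly_Mapping.keys m \<subseteq> {1..n}},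
      monoid.mult = (*), one = 1, zero = 0, add = (+)\<rparr>"

lemma poly_ring_cring: "cring (poly_ring n :: 'k::field mpoly ring)"
proof -
  let ?R = "poly_ring n :: 'k mpoly ring"
  have add_cl: "p + q \<in> carrier ?R" if "p \<in> carrier ?R" "q \<in> carrier ?R" for p q
    using that subsetD[OF Poly_Mapping.keys_add[of p q]] unfolding poly_ring_def by auto
  have exp_add: "Poly_Mapping.keys (a + b) \<subseteq> {1..n}"
    if "Poly_Mapping.keys a \<subseteq> {1..n}" "Poly_Mapping.keys b \<subseteq> {1..n}" for a b :: "nat \<Rightarrow>\<^sub>0 nat"
    using that Poly_Mapping.keys_add[of a b] by blast
  have mult_cl: "p * q \<in> carrier ?R" if p: "p \<in> carrier ?R" and q: "q \<in> carrier ?R" for p q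
  proof -
    have "Poly_Mapping.keys m \<subseteq> {1..n}" if m: "m \<in> Poly_Mapping.keys (p * q)" for m
    proof -
      from subsetD[OF keys_mult m] obtain a b where
        "m = a + b" "a \<in> Poly_Mapping.keys p" "b \<in> Poly_Mapping.keys q" by blast
      then show ?thesis using p q exp_add unfolding poly_ring_def by simp
    qed
    then show ?thesis unfolding poly_ring_def by simp
  qed
  have uminus_cl: "- p \<in> carrier ?R" if "p \<in> carrier ?R" for p
    using that by (simp add: poly_ring_def)
  have ops: "monoid.mult ?R = (*)" "monoid.one ?R = 1" "ring.zero ?R = 0" "ring.add ?R = (+)"
    by (simp_all add: poly_ring_def)
  have consts_cl: "0 \<in> carrier ?R" "1 \<in> carrier ?R"
    by (simp_all add: poly_ring_def)
  show ?thesis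
  proof (rule cringI)
    show "abelian_group ?R"
    proof (rule abelian_groupI)
      fix p assume "p \<in> carrier ?R"
      then show "\<exists>q \<in> carrier ?R. q \<oplus>\<^bsub>?R\<^esub> p = \<zero>\<^bsub>?R\<^esub>"
        using uminus_cl[of p] by (intro bexI[of _ "- p"]) (simp_all add: ops)
    qed (simp_all add: ops add_cl consts_cl add.assoc add.commute)
    show "Group.comm_monoid ?R"
      by (rule comm_monoidI) (simp_all add: ops mult_cl consts_cl mult.assoc mult.commute)
  qed (simp add: ops distrib_right)
qed

definition const_poly :: "'k \<Rightarrow> 'k::field mpoly" where
  "const_poly c = Poly_Mapping.single 0 c"

definition indet :: "nat \<Rightarrow> 'k::field mpoly" where
  "indet i = Poly_Mapping.single (Poly_Mapping.single i 1) 1"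

definition mono_of :: "nat \<Rightarrow> (nat \<Rightarrow> nat) \<Rightarrow> 'k::field mpoly" where
  "mono_of n b = (\<Prod>i = 1..n. indet i ^ b i)"

text \<open>
  \<open>has_quot_dim n J d\<close> states that $k[x_1,\dots,x_n]/J$ has finite $k$-dimension \<open>d\<close>; for a
  proper ideal \<open>J\<close> the scalar field is the (isomorphic) image of $k$ in the quotient.
\<close>

definition has_quot_dim :: "nat \<Rightarrow> 'k::field mpoly set \<Rightarrow> nat \<Rightarrow> bool" where
  "has_quot_dim n J d \<longleftrightarrow>
     ring.dimension (poly_ring n Quot J) d
       (range (\<lambda>c. J +>\<^bsub>poly_ring n\<^esub> const_poly c)) (carrier (poly_ring n Quot J))"

text \<open>
  Exponents of the minimal generators of a monomial ideal: those occurring in an irredundant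
  generating set of monomials (there is exactly one such set).
\<close>

definition min_gen_exps :: "nat \<Rightarrow> 'k::field mpoly set \<Rightarrow> (nat \<Rightarrow> nat) set" where
  "min_gen_exps n I =
     \<Union> {B. B \<subseteq> ({1..n} \<rightarrow>\<^sub>E UNIV) \<and>
            Idl\<^bsub>poly_ring n\<^esub> (mono_of n ` B) = I \<and>
            (\<forall>B'. B' \<subset> B \<longrightarrow> Idl\<^bsub>poly_ring n\<^esub> (mono_of n ` B') \<noteq> I)}"

text \<open>
  The dual with respect to \<open>u\<close> is meant for ideals whose minimal generators have exponents
  at most \<open>u\<close>, so that the subtraction does not truncate.
\<close>

definition alexander_dual :: "nat \<Rightarrow> (nat \<Rightarrow> nat) \<Rightarrow> 'k::field mpoly set \<Rightarrow> 'k mpoly set" where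
  "alexander_dual n u I =
     carrier (poly_ring n) \<inter>
     (\<Inter>b \<in> min_gen_exps n I. Idl\<^bsub>poly_ring n\<^esub> {indet i ^ (u i + 1 - b i) | i. i \<in> {1..n} \<and> b i \<ge> 1})"

definition perm_ideal :: "nat \<Rightarrow> (nat \<Rightarrow> nat) set \<Rightarrow> 'k::field mpoly set" where
  "perm_ideal n S = Idl\<^bsub>poly_ring n\<^esub> (mono_of n ` S)"

text \<open>
  Patterns are one-line notations; \<open>f r\<close> is the position in \<open>\<sigma>\<close> of the entry playing the role
  of \<open>\<tau> ! r\<close>.
\<close>

definition contains_pattern :: "nat \<Rightarrow> (nat \<Rightarrow> nat) \<Rightarrow> nat list \<Rightarrow> bool" where
  "contains_pattern n \<sigma> \<tau> \<longleftrightarrow>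
     (\<exists>f. f ` {..<length \<tau>} \<subseteq> {1..n} \<and> strict_mono_on {..<length \<tau>} f \<and>
          (\<forall>r < length \<tau>. \<forall>s < length \<tau>. \<sigma> (f r) < \<sigma> (f s) \<longleftrightarrow> \<tau> ! r < \<tau> ! s))"

definition avoiders :: "nat \<Rightarrow> nat list set \<Rightarrow> (nat \<Rightarrow> nat) set" where
  "avoiders n T = {\<sigma>. \<sigma> permutes {1..n} \<and> (\<forall>\<tau> \<in> T. \<not> contains_pattern n \<sigma> \<tau>)}"

definition S1 :: "nat \<Rightarrow> (nat \<Rightarrow> nat) set" where
  "S1 n = avoiders n {[1,2,3], [1,3,2], [3,1,2]}"

definition S2 :: "nat \<Rightarrow> (nat \<Rightarrow> nat) set" where
  "S2 n = avoiders n {[1,2,3], [2,1,3], [2,3,1]}"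

definition S3 :: "nat \<Rightarrow> (nat \<Rightarrow> nat) set" where
  "S3 n = avoiders n {[1,3,2], [2,1,3], [2,3,1]}"

text \<open>The list index \<open>j - 1\<close> accounts for lists being indexed from 0.\<close>

definition PF :: "nat \<Rightarrow> (nat \<Rightarrow> nat) set" where
  "PF n = {p \<in> {1..n} \<rightarrow>\<^sub>E UNIV. \<forall>j \<in> {1..n}. sort (map p [1..<Suc n]) ! (j - 1) < j}"

definition PF1 :: "nat \<Rightarrow> (nat \<Rightarrow> nat) set" where
  "PF1 n = {p \<in> PF n. (\<forall>t \<in> {1..n}. p t \<le> t) \<and>
                      (\<forall>i \<in> {1..n}. p i = i \<longrightarrow> (\<exists>j \<in> {i..n}. p j = 0))}"

definition PF2 :: "nat \<Rightarrow> (nat \<Rightarrow> nat) set" where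
  "PF2 n = {p \<in> PF n. \<forall>i \<in> {1..n}. p i \<ge> i \<longrightarrow> (\<forall>j \<in> {i+1..n}. p j < j - 1)}"

definition PF3 :: "nat \<Rightarrow> (nat \<Rightarrow> nat) set" where
  "PF3 n = {p \<in> PF n. \<forall>i \<in> {1..n}. p i \<ge> i \<longrightarrow> (\<forall>j \<in> {i+1..n}. p j < n - (j - i))}"

end

theory Submission
  imports Defs
begin

text \<open>
  All permutations have the same entry sum, so the monomials of \<open>S\<close> form an antichain and are the
  minimal generators of \<open>perm_ideal n S\<close>. Hence $x^p$ lies outside the Alexander dual iff
  $p_i \<le> n - \sigma(i)$ for all $i$, for some $\sigma \in S$. The permutations of \<open>S\<^sub>1\<close>, resp. \<open>S\<^sub>2\<close>,
  are those which decrease away from the position $k$ of the value $n$, resp. $1$; those of \<open>S\<^sub>3\<close>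
  decrease before the position $k$ of $1$, increase after it, and have the larger values
  before $k$. So there is one permutation for each $k$, and the standard exponents are a union of $n$
  explicit boxes; these unions are the sets \<open>PF\<^sub>a\<close>. Cutting \<open>PF\<^sub>1\<close> by its last zero
  and \<open>PF\<^sub>2\<close>, \<open>PF\<^sub>3\<close> by the first $k$ with $p_k \<ge> k$ gives disjoint boxes, of cardinalities
  $k\,(n-1)!$, resp. $(n-k)\,(n-1)!$ (and $n!$ if there is no such $k$).
\<close>

subsection \<open>Monomial ideals and their quotients\<close>

text \<open>The exponents of the monomials that survive in the quotient by the dual. The bound
  \<open>p i \<le> n - \<sigma> i\<close> is written additively to avoid truncated
  subtraction.\<close>

definition standard_exps :: "nat \<Rightarrow> (nat \<Rightarrow> nat) set \<Rightarrow> (nat \<Rightarrow> nat) set" where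
  "standard_exps n S = {p \<in> {1..n} \<rightarrow>\<^sub>E UNIV. \<exists>\<sigma>\<in>S. \<forall>i\<in>{1..n}. p i + \<sigma> i \<le> n}"

definition exps :: "nat \<Rightarrow> (nat \<Rightarrow>\<^sub>0 nat) set" where
  "exps n = {m. Poly_Mapping.keys m \<subseteq> {1..n}}"

text \<open>If \<open>U\<close> is closed under adding exponents, this is the monomial ideal with
  exponent set \<open>U\<close>. The complement of \<open>U\<close> then gives the normal forms
  modulo that ideal, and \<open>U = exps n\<close> gives the ring itself.\<close>

definition supported :: "(nat \<Rightarrow>\<^sub>0 nat) set \<Rightarrow> 'k::field mpoly set" where
  "supported U = {p. Poly_Mapping.keys p \<subseteq> U}"

definition multiples :: "nat \<Rightarrow> (nat \<Rightarrow>\<^sub>0 nat) set \<Rightarrow> (nat \<Rightarrow>\<^sub>0 nat) set" where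
  "multiples n M = {m \<in> exps n. \<exists>u\<in>M. \<forall>i. Poly_Mapping.lookup u i \<le> Poly_Mapping.lookup m i}"

text \<open>Only the values of \<open>b\<close> on \<open>{1..n}\<close> enter, so a permutation and
  its restriction give the same monomial.\<close>

definition exponent :: "nat \<Rightarrow> (nat \<Rightarrow> nat) \<Rightarrow> nat \<Rightarrow>\<^sub>0 nat" where
  "exponent n b = (\<Sum>i = 1..n. Poly_Mapping.single i (b i))"

section \<open>Polynomials with prescribed exponents\<close>

lemma poly_ring_simps:
  "carrier (poly_ring n) = supported (exps n)" "\<zero>\<^bsub>poly_ring n\<^esub> = 0" "\<one>\<^bsub>poly_ring n\<^esub> = 1"
  "p \<oplus>\<^bsub>poly_ring n\<^esub> q = p + q" "p \<otimes>\<^bsub>poly_ring n\<^esub> q = p * q"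
  by (auto simp: poly_ring_def supported_def exps_def)

lemma exps_add: "a \<in> exps n \<Longrightarrow> b \<in> exps n \<Longrightarrow> a + b \<in> exps n"
  using Poly_Mapping.keys_add[of a b] unfolding exps_def by blast

lemma supported_mono: "U \<subseteq> V \<Longrightarrow> supported U \<subseteq> supported V"
  by (auto simp: supported_def)

lemma supported_zero: "0 \<in> supported U"
  by (simp add: supported_def)

lemma supported_add: "p \<in> supported U \<Longrightarrow> q \<in> supported U \<Longrightarrow> p + q \<in> supported U"
  using Poly_Mapping.keys_add[of p q] by (auto simp: supported_def)

lemma supported_uminus: "p \<in> supported U \<Longrightarrow> - p \<in> supported U"
  by (simp add: supported_def)

lemma supported_diff: "p \<in> supported U \<Longrightarrow> q \<in> supported U \<Longrightarrow> p - q \<in> supported U"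
  using supported_add[OF _ supported_uminus, of p U q] by simp

lemma supported_single: "m \<in> U \<Longrightarrow> Poly_Mapping.single m c \<in> supported U"
  by (simp add: supported_def)

lemma single_in_supported_iff: "Poly_Mapping.single m (1::'k::field) \<in> supported U \<longleftrightarrow> m \<in> U"
  by (simp add: supported_def)

text \<open>Peels off the term at \<open>m\<close>, the step of every induction over a finite
  support.\<close>

lemma supported_split:
  assumes "p \<in> supported (insert m F)"
  obtains q where "q \<in> supported F" "p = Poly_Mapping.single m (Poly_Mapping.lookup p m) + q"
proof
  let ?q = "p - Poly_Mapping.single m (Poly_Mapping.lookup p m)"
  have "x \<in> F" if "x \<in> Poly_Mapping.keys ?q" for x
    using that assms
    by (cases "x = m") (auto simp: supported_def in_keys_iff lookup_minus lookup_single_not_eq)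
  then show "?q \<in> supported F"
    by (auto simp: supported_def)
qed simp

text \<open>Each exponent of a product \<open>q * p\<close> is a sum \<open>w + u\<close> of an
  exponent of \<open>q\<close> and one of \<open>p\<close>, so closure of \<open>U\<close> under
  such sums gives absorption.\<close>

lemma supported_ideal:
  assumes U: "U \<subseteq> exps n" and up: "\<And>w u. w \<in> exps n \<Longrightarrow> u \<in> U \<Longrightarrow> w + u \<in> U"
  shows "ideal (supported U :: 'k::field mpoly set) (poly_ring n)"
proof -
  interpret cring "poly_ring n :: 'k mpoly ring" by (rule poly_ring_cring)
  have sub: "supported U \<subseteq> supported (exps n)" by (rule supported_mono[OF U])
  have mult: "q * p \<in> supported U"
    if "p \<in> supported U" "q \<in> supported (exps n)" for p q :: "'k mpoly"
    using that up keys_mult[of q p] by (fastforce simp: supported_def)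
  have mult': "p * q \<in> supported U"
    if "p \<in> supported U" "q \<in> supported (exps n)" for p q :: "'k mpoly"
    using mult[OF that] by (simp add: mult.commute)
  show ?thesis
  proof (rule idealI)
    show "subgroup (supported U) (add_monoid (poly_ring n :: 'k mpoly ring))"
    proof (rule add.subgroupI)
      fix p :: "'k mpoly" assume p: "p \<in> supported U"
      have "\<ominus>\<^bsub>poly_ring n\<^esub> p = - p"
        using p sub by (intro minus_equality) (auto simp: poly_ring_simps intro: supported_uminus)
      then show "\<ominus>\<^bsub>poly_ring n\<^esub> p \<in> supported U"
        using p by (simp add: supported_uminus)
    qed (use sub supported_zero in \<open>auto simp: poly_ring_simps supported_add\<close>)
  qed (auto simp: ring_axioms poly_ring_simps mult mult')
qed

text \<open>A polynomial is the finite sum of its terms, and an ideal is closed under sums.\<close>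

lemma supported_finite_subset_ideal:
  fixes J :: "'k::field mpoly set"
  assumes J: "ideal J (poly_ring n)" and "finite F"
    and mem: "\<And>m c. m \<in> F \<Longrightarrow> Poly_Mapping.single m c \<in> J"
  shows "supported F \<subseteq> J"
  using \<open>finite F\<close> mem
proof (induction F)
  case empty
  show ?case
    using additive_subgroup.zero_closed[OF ideal.axioms(1)[OF J]]
    by (auto simp: supported_def poly_ring_simps)
next
  case (insert m F)
  show ?case
  proof
    fix p :: "'k mpoly" assume "p \<in> supported (insert m F)"
    then obtain q where q: "q \<in> supported F"
      and p: "p = Poly_Mapping.single m (Poly_Mapping.lookup p m) + q"
      by (rule supported_split)
    have "q \<in> J" "Poly_Mapping.single m (Poly_Mapping.lookup p m) \<in> J"
      using insert q by auto
    then show "p \<in> J"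
      using additive_subgroup.a_closed[OF ideal.axioms(1)[OF J]] p
      by (metis poly_ring_simps(4))
  qed
qed

section \<open>Ideals generated by monomials\<close>

lemma multiples_up:
  assumes "w \<in> exps n" "u \<in> multiples n M"
  shows "w + u \<in> multiples n M"
  using assms by (auto simp: multiples_def lookup_add exps_add intro!: trans_le_add2)

lemma multiples_self: "M \<subseteq> exps n \<Longrightarrow> M \<subseteq> multiples n M"
  by (auto simp: multiples_def)

text \<open>The cofactor is \<open>m - u\<close>; this pointwise truncated subtraction is exact
  because \<open>u\<close> lies below \<open>m\<close>.\<close>

lemma multiple_eq_add:
  assumes "m \<in> multiples n M"
  obtains w u where "w \<in> exps n" "u \<in> M" "m = w + u"
proof -
  obtain u where u: "u \<in> M" "\<And>i. Poly_Mapping.lookup u i \<le> Poly_Mapping.lookup m i"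
    using assms by (auto simp: multiples_def)
  have m: "m = (m - u) + u"
    by (rule poly_mapping_eqI) (simp add: lookup_add lookup_minus u(2))
  have "Poly_Mapping.keys (m - u) \<subseteq> Poly_Mapping.keys m"
    by (auto simp: in_keys_iff lookup_minus)
  then have "m - u \<in> exps n"
    using assms by (auto simp: multiples_def exps_def)
  then show ?thesis using that u(1) m by blast
qed

text \<open>The right side is an ideal containing the generators. Conversely, a term with exponent
  \<open>w + u\<close>, \<open>u \<in> M\<close>, is a ring element times the generator with
  exponent \<open>u\<close>.\<close>

lemma Idl_monomials:
  assumes M: "M \<subseteq> exps n"
  shows "Idl\<^bsub>poly_ring n\<^esub> ((\<lambda>m. Poly_Mapping.single m (1::'k::field)) ` M) = supported (multiples n M)"
    (is "Idl\<^bsub>_\<^esub> ?G = _")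
proof -
  interpret cring "poly_ring n :: 'k mpoly ring" by (rule poly_ring_cring)
  have G: "?G \<subseteq> carrier (poly_ring n)"
    using M by (auto simp: poly_ring_simps intro: supported_single)
  have id: "ideal (Idl\<^bsub>poly_ring n\<^esub> ?G) (poly_ring n)" by (rule genideal_ideal[OF G])
  show ?thesis
  proof
    show "Idl\<^bsub>poly_ring n\<^esub> ?G \<subseteq> supported (multiples n M)"
      using multiples_self[OF M]
      by (intro genideal_minimal supported_ideal)
         (auto simp: multiples_up intro: supported_single, auto simp: multiples_def)
    show "supported (multiples n M) \<subseteq> Idl\<^bsub>poly_ring n\<^esub> ?G"
    proof
      fix p :: "'k mpoly" assume p: "p \<in> supported (multiples n M)"
      \<comment> \<open>\<open>multiples n M\<close> may be infinite, so the finite lemma is applied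
        to the support of the single polynomial \<open>p\<close>.\<close>
      have "supported (Poly_Mapping.keys p) \<subseteq> Idl\<^bsub>poly_ring n\<^esub> ?G"
      proof (rule supported_finite_subset_ideal[OF id])
        fix m :: "nat \<Rightarrow>\<^sub>0 nat" and c :: 'k assume "m \<in> Poly_Mapping.keys p"
        then have "m \<in> multiples n M" using p by (auto simp: supported_def)
        then obtain w u where wu: "w \<in> exps n" "u \<in> M" "m = w + u" by (rule multiple_eq_add)
        have "Poly_Mapping.single u 1 \<in> Idl\<^bsub>poly_ring n\<^esub> ?G"
          using genideal_self[OF G] wu(2) by auto
        then have "Poly_Mapping.single w c \<otimes>\<^bsub>poly_ring n\<^esub> Poly_Mapping.single u 1 \<in> Idl\<^bsub>poly_ring n\<^esub> ?G"
          using wu(1) by (intro ideal.I_l_closed[OF id]) (auto simp: poly_ring_simps intro: supported_single)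
        then show "Poly_Mapping.single m c \<in> Idl\<^bsub>poly_ring n\<^esub> ?G"
          by (simp add: poly_ring_simps mult_single wu(3))
      qed simp
      then show "p \<in> Idl\<^bsub>poly_ring n\<^esub> ?G"
        by (auto simp: supported_def)
    qed
  qed
qed

section \<open>Variables and monomials in terms of exponents\<close>

lemma indet_power: "indet i ^ k = Poly_Mapping.single (Poly_Mapping.single i k) (1::'k::field)"
  by (induction k) (simp_all add: indet_def mult_single single_add[symmetric])

lemma prod_single:
  "finite A \<Longrightarrow> (\<Prod>i\<in>A. Poly_Mapping.single (f i) (1::'k::field)) = Poly_Mapping.single (\<Sum>i\<in>A. f i :: nat \<Rightarrow>\<^sub>0 nat) 1"
  by (induction A rule: finite_induct) (simp_all add: mult_single)

lemma mono_of_eq: "mono_of n b = Poly_Mapping.single (exponent n b) (1::'k::field)"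
  by (simp add: mono_of_def indet_power exponent_def prod_single)

lemma lookup_exponent: "Poly_Mapping.lookup (exponent n b) i = (if i \<in> {1..n} then b i else 0)"
  by (simp add: exponent_def lookup_sum lookup_single when_def sum.delta)

lemma exponent_in_exps: "exponent n b \<in> exps n"
  by (auto simp: exps_def in_keys_iff lookup_exponent split: if_splits)

lemma exponent_restrict: "exponent n (restrict b {1..n}) = exponent n b"
  by (simp add: exponent_def)

lemma Idl_mono_of:
  "Idl\<^bsub>poly_ring n\<^esub> (mono_of n ` B) = (supported (multiples n (exponent n ` B)) :: 'k::field mpoly set)"
  using Idl_monomials[of "exponent n ` B" n, where 'k = 'k] exponent_in_exps[of n]
  by (force simp: image_image mono_of_eq)

text \<open>Membership of a monomial in a monomial ideal is divisibility by one generator. Outside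
  \<open>{1..n}\<close> both exponents vanish, so only the coordinates in \<open>{1..n}\<close> are
  compared.\<close>

lemma mono_of_in_Idl_iff:
  "mono_of n b \<in> (Idl\<^bsub>poly_ring n\<^esub> (mono_of n ` B) :: 'k::field mpoly set)
     \<longleftrightarrow> (\<exists>c\<in>B. \<forall>i\<in>{1..n}. c i \<le> b i)"
proof -
  have "(\<forall>i. Poly_Mapping.lookup (exponent n c) i \<le> Poly_Mapping.lookup (exponent n b) i)
      \<longleftrightarrow> (\<forall>i\<in>{1..n}. c i \<le> b i)" for c
    unfolding lookup_exponent by (auto split: if_splits)
  then show ?thesis
    unfolding Idl_mono_of mono_of_eq single_in_supported_iff
    by (simp add: multiples_def exponent_in_exps)
qed

text \<open>The cosets of the monomials with exponent outside \<open>U\<close> form a basis of the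
  quotient. They are adjoined one at a time, each as a line extension of the span of the earlier
  ones.\<close>

lemma supported_quot_dim:
  assumes U: "U \<subseteq> exps n" and up: "\<And>w u. w \<in> exps n \<Longrightarrow> u \<in> U \<Longrightarrow> w + u \<in> U"
    and fin: "finite (exps n - U)"
  shows "has_quot_dim n (supported U :: 'k::field mpoly set) (card (exps n - U))"
proof -
  define J :: "'k mpoly set" where "J = supported U"
  let ?R = "poly_ring n :: 'k mpoly ring"
  let ?cos = "\<lambda>p. J +>\<^bsub>?R\<^esub> p"
  let ?K = "range (\<lambda>c. ?cos (const_poly c))"
  interpret ideal J ?R unfolding J_def by (rule supported_ideal[OF U up])
  interpret Q: ring "?R Quot J" by (rule quotient_is_ring)
  \<comment> \<open>Cosets as sets of polynomials congruent modulo \<open>J\<close>: equality of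
    cosets becomes membership of a difference in \<open>J\<close>.\<close>
  have cos: "?cos p = {q. q - p \<in> J}" for p
  proof (intro equalityI subsetI)
    fix q assume "q \<in> {q. q - p \<in> J}"
    then show "q \<in> ?cos p"
      by (auto simp: a_r_coset_def' poly_ring_simps intro!: bexI[of _ "q - p"])
  qed (auto simp: a_r_coset_def' poly_ring_simps)
  have cos_eqD: "p - q \<in> J" if "?cos p = ?cos q" for p q
  proof -
    have "p \<in> ?cos p" unfolding cos by (simp add: J_def supported_zero)
    then have "p \<in> ?cos q" by (simp only: that)
    then show ?thesis unfolding cos by simp
  qed
  have cos_eqI: "?cos p = ?cos q" if "p - q \<in> J" for p q
  proof -
    have "r - p \<in> J \<longleftrightarrow> r - q \<in> J" for r
      using supported_add[OF that[unfolded J_def], of "r - p"]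
        supported_diff[OF _ that[unfolded J_def], of "r - q"]
      by (auto simp: J_def algebra_simps)
    then show ?thesis unfolding cos by auto
  qed
  have carr: "supported V \<subseteq> carrier ?R" if "V \<subseteq> exps n" for V
    using supported_mono[OF that] by (simp add: poly_ring_simps)
  have const: "const_poly c \<in> carrier ?R" for c
    by (auto simp: poly_ring_simps const_poly_def exps_def intro!: supported_single)
  have dim: "Q.dimension (card F) ?K (?cos ` supported F)"
    if "finite F" "F \<subseteq> exps n - U" for F
    using that
  proof (induction F)
    case empty
    have "?cos ` supported {} = {\<zero>\<^bsub>?R Quot J\<^esub>}"
      by (auto simp: supported_def FactRing_def cos)
    then show ?case using Q.zero_dim by simp
  next
    case (insert m F)
    let ?x = "Poly_Mapping.single m (1::'k)"
    let ?v = "?cos ?x"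
    have x: "?x \<in> carrier ?R"
      using insert.prems by (auto simp: poly_ring_simps intro: supported_single)
    have v: "?v \<in> carrier (?R Quot J)"
      using ring_hom_closed[OF rcos_ring_hom x] .
    \<comment> \<open>Linear independence: \<open>?x - p\<close> has coefficient 1 at
      \<open>m\<close>, while elements of \<open>J\<close> have exponents in \<open>U\<close> only
      and \<open>m \<notin> U\<close>.\<close>
    have vF: "?v \<notin> ?cos ` supported F"
    proof
      assume "?v \<in> ?cos ` supported F"
      then obtain p where p: "p \<in> supported F" "?v = ?cos p" by auto
      have "?x - p \<in> J" using cos_eqD p(2) by blast
      moreover have "m \<in> Poly_Mapping.keys (?x - p)"
      proof -
        have "m \<notin> Poly_Mapping.keys p" using p(1) insert.hyps(2) by (auto simp: supported_def)
        then show ?thesis by (simp add: in_keys_iff lookup_minus)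
      qed
      ultimately show False using insert.prems by (auto simp: J_def supported_def)
    qed
    \<comment> \<open>Scalars are cosets of constants, and a constant \<open>c\<close> times
      \<open>x^m\<close> is the term \<open>single m c\<close>; thus the line extension matches the
      splitting of a polynomial at \<open>m\<close>.\<close>
    have comb: "?cos (const_poly c) \<otimes>\<^bsub>?R Quot J\<^esub> ?v \<oplus>\<^bsub>?R Quot J\<^esub> ?cos p
        = ?cos (Poly_Mapping.single m c + p)" if "p \<in> supported F" for c p
    proof -
      have p: "p \<in> carrier ?R" using carr[of F] that insert.prems by auto
      have "?cos (Poly_Mapping.single m c + p) = ?cos (const_poly c \<otimes>\<^bsub>?R\<^esub> ?x \<oplus>\<^bsub>?R\<^esub> p)"
        by (simp add: poly_ring_simps const_poly_def mult_single)
      also have "\<dots> = ?cos (const_poly c) \<otimes>\<^bsub>?R Quot J\<^esub> ?v \<oplus>\<^bsub>?R Quot J\<^esub> ?cos p"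
        using ring_hom_add[OF rcos_ring_hom m_closed[OF const x] p] ring_hom_mult[OF rcos_ring_hom const x]
        by simp
      finally show ?thesis by simp
    qed
    have "Q.line_extension ?K ?v (?cos ` supported F) = ?cos ` supported (insert m F)"
    proof (intro equalityI subsetI)
      fix y assume "y \<in> Q.line_extension ?K ?v (?cos ` supported F)"
      then obtain c p where "p \<in> supported F" "y = ?cos (Poly_Mapping.single m c + p)"
        unfolding Q.line_extension_mem_iff using comb by auto
      moreover have "Poly_Mapping.single m c + p \<in> supported (insert m F)"
        using \<open>p \<in> supported F\<close> supported_mono[of F "insert m F"]
        by (intro supported_add supported_single) auto
      ultimately show "y \<in> ?cos ` supported (insert m F)" by blast
    next
      fix y assume "y \<in> ?cos ` supported (insert m F)"
      then obtain p where p: "p \<in> supported (insert m F)" "y = ?cos p" by auto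
      then obtain q where "q \<in> supported F"
        "p = Poly_Mapping.single m (Poly_Mapping.lookup p m) + q"
        by (blast elim: supported_split)
      then show "y \<in> Q.line_extension ?K ?v (?cos ` supported F)"
        unfolding Q.line_extension_mem_iff using comb p(2)
        by (metis (no_types, lifting) image_eqI rangeI)
    qed
    then show ?case
      using Q.Suc_dim[OF v vF insert.IH] insert by simp
  qed
  have "?cos ` supported (exps n - U) = carrier (?R Quot J)"
  proof (intro equalityI subsetI)
    fix y assume "y \<in> carrier (?R Quot J)"
    then obtain p where "p \<in> carrier ?R" and y: "y = ?cos p"
      unfolding FactRing_simps by auto
    then have p: "p \<in> supported (exps n)" by (simp add: poly_ring_simps)
    \<comment> \<open>The normal form of \<open>p\<close>: its terms with exponent in
      \<open>U\<close> are deleted, and these terms lie in \<open>J\<close>.\<close>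
    define q where "q = Poly_Mapping.mapp (\<lambda>m c. if m \<in> U then 0 else c) p"
    have q: "Poly_Mapping.lookup q m = (if m \<in> U then 0 else Poly_Mapping.lookup p m)" for m
      by (auto simp: q_def lookup_mapp in_keys_iff when_def)
    have "q \<in> supported (exps n - U)"
      using p by (auto simp: supported_def in_keys_iff q split: if_splits)
    moreover have "p - q \<in> J"
      by (auto simp: J_def supported_def in_keys_iff lookup_minus q split: if_splits)
    ultimately show "y \<in> ?cos ` supported (exps n - U)"
      using y cos_eqI by blast
  next
    fix y assume "y \<in> ?cos ` supported (exps n - U)"
    then show "y \<in> carrier (?R Quot J)"
      using carr[of "exps n - U"] ring_hom_closed[OF rcos_ring_hom] by blast
  qed
  then show ?thesis
    using dim[OF fin] by (simp add: has_quot_dim_def J_def)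
qed

section \<open>Minimal generators and the Alexander dual of a permutation ideal\<close>

lemma perm_sum_le_imp_eq:
  assumes "\<sigma> permutes {1..n}" "\<rho> permutes {1..n}" "\<forall>i\<in>{1..n}. \<rho> i \<le> \<sigma> i" "i \<in> {1..n}"
  shows "\<rho> i = (\<sigma> i :: nat)"
proof (rule ccontr)
  assume "\<rho> i \<noteq> \<sigma> i"
  then have "(\<Sum>i\<in>{1..n}. \<rho> i) < (\<Sum>i\<in>{1..n}. \<sigma> i)"
    using assms by (intro sum_strict_mono_ex1) (auto simp: order_less_le)
  then show False
    using sum.permute[OF assms(1), of id] sum.permute[OF assms(2), of id] by (simp add: o_def)
qed

text \<open>Every monomial generating set contains the exponents coming from \<open>S\<close>, so
  these form the only irredundant one. Restriction to \<open>{1..n}\<close> is needed since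
  \<open>min_gen_exps\<close> collects extensional functions.\<close>

lemma min_gen_exps_perm_ideal:
  assumes S: "\<And>\<sigma>. \<sigma> \<in> S \<Longrightarrow> \<sigma> permutes {1..n}"
  shows "min_gen_exps n (perm_ideal n S :: 'k::field mpoly set) = (\<lambda>\<sigma>. restrict \<sigma> {1..n}) ` S"
proof -
  let ?I = "perm_ideal n S :: 'k mpoly set"
  let ?Idl = "\<lambda>B. Idl\<^bsub>poly_ring n\<^esub> (mono_of n ` B) :: 'k mpoly set"
  let ?S' = "(\<lambda>\<sigma>. restrict \<sigma> {1..n}) ` S"
  have ext: "?S' \<subseteq> {1..n} \<rightarrow>\<^sub>E UNIV" by auto
  have S': "?Idl ?S' = ?I"
    unfolding Idl_mono_of perm_ideal_def unfolding image_image exponent_restrict ..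
  \<comment> \<open>Some \<open>b \<in> B\<close> divides the generator of \<open>\<sigma>\<close>,
    and some generator \<open>\<rho>\<close> divides \<open>b\<close>. Then
    \<open>\<rho> \<le> b \<le> \<sigma>\<close> pointwise, and equal entry sums collapse the
    chain.\<close>
  have sub: "?S' \<subseteq> B" if B: "B \<subseteq> {1..n} \<rightarrow>\<^sub>E UNIV" and gen: "?Idl B = ?I" for B
  proof
    fix c assume "c \<in> ?S'"
    then obtain \<sigma> where \<sigma>: "\<sigma> \<in> S" "c = restrict \<sigma> {1..n}" by auto
    then have "mono_of n \<sigma> \<in> ?Idl B"
      unfolding gen perm_ideal_def mono_of_in_Idl_iff by blast
    then obtain b where b: "b \<in> B" "\<forall>i\<in>{1..n}. b i \<le> \<sigma> i"
      unfolding mono_of_in_Idl_iff by blast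
    then have "mono_of n b \<in> ?I"
      unfolding gen[symmetric] mono_of_in_Idl_iff by blast
    then obtain \<rho> where \<rho>: "\<rho> \<in> S" "\<forall>i\<in>{1..n}. \<rho> i \<le> b i"
      unfolding perm_ideal_def mono_of_in_Idl_iff by blast
    have "b i = c i" if "i \<in> {1..n}" for i
    proof -
      have "\<rho> i = \<sigma> i"
        using perm_sum_le_imp_eq[OF S[OF \<sigma>(1)] S[OF \<rho>(1)] _ that] b(2) \<rho>(2)
        by (meson le_trans)
      then show ?thesis
        using b(2) \<rho>(2) \<sigma>(2) that by (metis le_antisym restrict_apply')
    qed
    moreover have "b \<in> {1..n} \<rightarrow>\<^sub>E UNIV" "c \<in> {1..n} \<rightarrow>\<^sub>E UNIV"
      using b(1) B \<sigma>(2) by auto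
    ultimately have "b = c" by (intro PiE_ext)
    then show "c \<in> B" using b(1) by simp
  qed
  show ?thesis
  proof (intro equalityI)
    show "min_gen_exps n ?I \<subseteq> ?S'"
      unfolding min_gen_exps_def
    proof (rule Union_least)
      fix B assume "B \<in> {B. B \<subseteq> {1..n} \<rightarrow>\<^sub>E UNIV \<and> ?Idl B = ?I \<and> (\<forall>B'. B' \<subset> B \<longrightarrow> ?Idl B' \<noteq> ?I)}"
      then have B: "B \<subseteq> {1..n} \<rightarrow>\<^sub>E UNIV" "?Idl B = ?I" "\<And>B'. B' \<subset> B \<Longrightarrow> ?Idl B' \<noteq> ?I"
        by simp_all
      have "\<not> ?S' \<subset> B" using B(3) S' by (meson)
      with sub[OF B(1,2)] have "?S' = B" by (simp add: psubset_eq)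
      then show "B \<subseteq> ?S'" by simp
    qed
    \<comment> \<open>Irredundance: a generating \<open>B'\<close> would contain \<open>?S'\<close>
      by \<open>sub\<close>, so it cannot be a proper subset.\<close>
    have "?Idl B' \<noteq> ?I" if "B' \<subset> ?S'" for B'
    proof
      assume "?Idl B' = ?I"
      moreover have "B' \<subseteq> {1..n} \<rightarrow>\<^sub>E UNIV" using that ext by (meson psubsetE subset_trans)
      ultimately show False using sub[of B'] that by (meson psubsetE)
    qed
    with ext S' show "?S' \<subseteq> min_gen_exps n ?I"
      unfolding min_gen_exps_def by (intro Union_upper CollectI conjI) (assumption, assumption, simp)
  qed
qed

text \<open>Divisibility by a pure power of one variable is decided at that coordinate
  alone.\<close>

lemma Idl_indet_powers:
  fixes e :: "nat \<Rightarrow> nat"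
  shows "Idl\<^bsub>poly_ring n\<^esub> {indet i ^ e i | i. i \<in> {1..n}}
    = (supported {m \<in> exps n. \<exists>i\<in>{1..n}. e i \<le> Poly_Mapping.lookup m i} :: 'k::field mpoly set)"
proof -
  let ?M = "(\<lambda>i. Poly_Mapping.single i (e i)) ` {1..n}"
  have "?M \<subseteq> exps n"
    by (auto simp: exps_def split: if_splits)
  moreover have "multiples n ?M = {m \<in> exps n. \<exists>i\<in>{1..n}. e i \<le> Poly_Mapping.lookup m i}"
  proof -
    have "(\<forall>j. Poly_Mapping.lookup (Poly_Mapping.single i (e i)) j \<le> Poly_Mapping.lookup m j)
        \<longleftrightarrow> e i \<le> Poly_Mapping.lookup m i" for i m
      by (auto simp: lookup_single when_def)
    then show ?thesis by (simp add: multiples_def)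
  qed
  moreover have "{indet i ^ e i | i. i \<in> {1..n}} = (\<lambda>m. Poly_Mapping.single m (1::'k)) ` ?M"
    by (auto simp: indet_power)
  ultimately show ?thesis
    using Idl_monomials by metis
qed

text \<open>Permutation entries are positive, so the condition \<open>b i \<ge> 1\<close> excludes
  no variable and each component is generated by powers of all of them. Intersecting monomial ideals
  intersects their exponent sets.\<close>

lemma alexander_dual_perm_ideal:
  assumes S: "\<And>\<sigma>. \<sigma> \<in> S \<Longrightarrow> \<sigma> permutes {1..n}"
  shows "alexander_dual n (\<lambda>_. n) (perm_ideal n S :: 'k::field mpoly set)
    = supported {m \<in> exps n. \<forall>\<sigma>\<in>S. \<exists>i\<in>{1..n}. n + 1 - \<sigma> i \<le> Poly_Mapping.lookup m i}"
proof -
  have gens: "min_gen_exps n (perm_ideal n S :: 'k mpoly set) = (\<lambda>\<sigma>. restrict \<sigma> {1..n}) ` S"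
    by (rule min_gen_exps_perm_ideal) (rule S)
  have "{indet i ^ (n + 1 - restrict \<sigma> {1..n} i) |i. i \<in> {1..n} \<and> 1 \<le> restrict \<sigma> {1..n} i}
      = ({indet i ^ (n + 1 - \<sigma> i) |i. i \<in> {1..n}} :: 'k mpoly set)" if "\<sigma> \<in> S" for \<sigma>
  proof -
    have pos: "1 \<le> \<sigma> i" if "i \<in> {1..n}" for i
      using permutes_in_image[OF S[OF \<open>\<sigma> \<in> S\<close>], of i] that by simp
    have "u = indet i ^ (n + 1 - restrict \<sigma> {1..n} i) \<and> i \<in> {1..n} \<and> 1 \<le> restrict \<sigma> {1..n} i
        \<longleftrightarrow> u = indet i ^ (n + 1 - \<sigma> i) \<and> i \<in> {1..n}" for u :: "'k mpoly" and i
      using pos[of i] by (cases "i \<in> {1..n}") (simp_all only: restrict_apply' simp_thms)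
    then show ?thesis by (simp only:)
  qed
  then have *: "Idl\<^bsub>poly_ring n\<^esub> {indet i ^ (n + 1 - restrict \<sigma> {1..n} i) |i. i \<in> {1..n} \<and> 1 \<le> restrict \<sigma> {1..n} i}
      = (supported {m \<in> exps n. \<exists>i\<in>{1..n}. n + 1 - \<sigma> i \<le> Poly_Mapping.lookup m i} :: 'k mpoly set)"
    if "\<sigma> \<in> S" for \<sigma>
    using that by (simp only: Idl_indet_powers)
  have "alexander_dual n (\<lambda>_. n) (perm_ideal n S :: 'k::field mpoly set)
      = supported (exps n) \<inter> (\<Inter>\<sigma>\<in>S. supported {m \<in> exps n. \<exists>i\<in>{1..n}. n + 1 - \<sigma> i \<le> Poly_Mapping.lookup m i})"
    unfolding alexander_dual_def gens poly_ring_simps image_image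
    by (intro arg_cong2[where f = "(\<inter>)"] INF_cong refl) (rule *)
  then show ?thesis
    by (simp only: supported_def) blast
qed

text \<open>Passes from finitely supported exponents, which index the basis, to the extensional
  functions used for parking functions.\<close>

lemma bij_betw_lookup_restrict:
  "bij_betw (\<lambda>m. restrict (Poly_Mapping.lookup m) {1..n})
     {m \<in> exps n. Q (restrict (Poly_Mapping.lookup m) {1..n})} {p \<in> {1..n} \<rightarrow>\<^sub>E UNIV. Q p}"
proof (rule bij_betw_byWitness[where f' = "exponent n"])
  show "\<forall>m\<in>{m \<in> exps n. Q (restrict (Poly_Mapping.lookup m) {1..n})}.
      exponent n (restrict (Poly_Mapping.lookup m) {1..n}) = m"
  proof (intro ballI poly_mapping_eqI)
    fix m i assume "m \<in> {m \<in> exps n. Q (restrict (Poly_Mapping.lookup m) {1..n})}"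
    then have "Poly_Mapping.keys m \<subseteq> {1..n}" by (simp add: exps_def)
    then show "Poly_Mapping.lookup (exponent n (restrict (Poly_Mapping.lookup m) {1..n})) i = Poly_Mapping.lookup m i"
      by (auto simp: exponent_restrict lookup_exponent in_keys_iff)
  qed
  have *: "restrict (Poly_Mapping.lookup (exponent n p)) {1..n} = p" if "p \<in> {1..n} \<rightarrow>\<^sub>E UNIV" for p
    using that by (intro PiE_ext[OF _ that]) (auto simp: lookup_exponent)
  then show "\<forall>p\<in>{p \<in> {1..n} \<rightarrow>\<^sub>E UNIV. Q p}. restrict (Poly_Mapping.lookup (exponent n p)) {1..n} = p"
    by blast
  show "exponent n ` {p \<in> {1..n} \<rightarrow>\<^sub>E UNIV. Q p} \<subseteq> {m \<in> exps n. Q (restrict (Poly_Mapping.lookup m) {1..n})}"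
    using * by (auto simp: exponent_in_exps)
qed auto

lemma finite_standard_exps: "finite (standard_exps n S)"
proof (rule finite_subset)
  show "standard_exps n S \<subseteq> {1..n} \<rightarrow>\<^sub>E {0..n}"
  proof
    fix p assume "p \<in> standard_exps n S"
    then obtain \<sigma> where "p \<in> {1..n} \<rightarrow>\<^sub>E UNIV" "\<forall>i\<in>{1..n}. p i + \<sigma> i \<le> n"
      by (auto simp: standard_exps_def)
    then show "p \<in> {1..n} \<rightarrow>\<^sub>E {0..n}"
      by (intro PiE_I) (auto dest: PiE_arb add_leD1)
  qed
qed (simp add: finite_PiE)

text \<open>The dimension counts the exponents outside the dual, and
  \<open>bij_betw_lookup_restrict\<close> carries these to \<open>standard_exps\<close>.\<close>

lemma has_quot_dim_alexander_dual:
  assumes S: "\<And>\<sigma>. \<sigma> \<in> S \<Longrightarrow> \<sigma> permutes {1..n}"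
  shows "has_quot_dim n (alexander_dual n (\<lambda>_. n) (perm_ideal n S) :: 'k::field mpoly set)
    (card (standard_exps n S))"
proof -
  let ?U = "{m \<in> exps n. \<forall>\<sigma>\<in>S. \<exists>i\<in>{1..n}. n + 1 - \<sigma> i \<le> Poly_Mapping.lookup m i}"
  have up: "w + u \<in> ?U" if w: "w \<in> exps n" and u: "u \<in> ?U" for w u
  proof (intro CollectI conjI ballI)
    show "w + u \<in> exps n" using w u by (simp add: exps_add)
    fix \<sigma> assume "\<sigma> \<in> S"
    then obtain i where "i \<in> {1..n}" "n + 1 - \<sigma> i \<le> Poly_Mapping.lookup u i" using u by blast
    then show "\<exists>i\<in>{1..n}. n + 1 - \<sigma> i \<le> Poly_Mapping.lookup (w + u) i"
      unfolding lookup_add using trans_le_add2 by blast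
  qed
  let ?Q = "\<lambda>p. \<exists>\<sigma>\<in>S. \<forall>i\<in>{1..n}. p i + \<sigma> i \<le> n"
  \<comment> \<open>Here \<open>\<sigma> i \<le> n\<close>, so the subtraction is exact.\<close>
  have "n + 1 - \<sigma> i \<le> x \<longleftrightarrow> \<not> x + \<sigma> i \<le> n" if "\<sigma> \<in> S" "i \<in> {1..n}" for \<sigma> i x
    using permutes_in_image[OF S[OF that(1)], of i] that(2) by auto
  then have "(\<forall>\<sigma>\<in>S. \<exists>i\<in>{1..n}. n + 1 - \<sigma> i \<le> Poly_Mapping.lookup m i)
      \<longleftrightarrow> \<not> ?Q (restrict (Poly_Mapping.lookup m) {1..n})" for m
    by simp
  then have "exps n - ?U = {m \<in> exps n. ?Q (restrict (Poly_Mapping.lookup m) {1..n})}"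
    by blast
  then have bij: "bij_betw (\<lambda>m. restrict (Poly_Mapping.lookup m) {1..n}) (exps n - ?U) (standard_exps n S)"
    using bij_betw_lookup_restrict[of n ?Q] by (simp add: standard_exps_def)
  have "finite (exps n - ?U)"
    using bij_betw_finite[OF bij] finite_standard_exps by blast
  moreover have "?U \<subseteq> exps n" by blast
  ultimately have "has_quot_dim n (supported ?U :: 'k mpoly set) (card (exps n - ?U))"
    by (intro supported_quot_dim up)
  moreover have "alexander_dual n (\<lambda>_. n) (perm_ideal n S :: 'k mpoly set) = supported ?U"
    by (rule alexander_dual_perm_ideal) (rule S)
  ultimately show ?thesis
    by (simp only: bij_betw_same_card[OF bij])
qed

subsection \<open>Pattern avoiding permutations\<close>

text \<open>Unfolds the embedding into its three positions. The two directions of each comparison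
  come from the ordered pairs of distinct indices; equal indices give nothing.\<close>

lemma contains_pattern_triple:
  "contains_pattern n \<sigma> [a, b, c] \<longleftrightarrow>
    (\<exists>x y z. 1 \<le> x \<and> x < y \<and> y < z \<and> z \<le> n \<and>
      (\<sigma> x < \<sigma> y \<longleftrightarrow> a < b) \<and> (\<sigma> y < \<sigma> x \<longleftrightarrow> b < a) \<and>
      (\<sigma> x < \<sigma> z \<longleftrightarrow> a < c) \<and> (\<sigma> z < \<sigma> x \<longleftrightarrow> c < a) \<and>
      (\<sigma> y < \<sigma> z \<longleftrightarrow> b < c) \<and> (\<sigma> z < \<sigma> y \<longleftrightarrow> c < b))"
    (is "?L \<longleftrightarrow> ?R")
proof
  assume ?L
  then obtain f where f: "f ` {..<3} \<subseteq> {1..n}" "strict_mono_on {..<3} f"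
    "\<And>r s. r < 3 \<Longrightarrow> s < 3 \<Longrightarrow> \<sigma> (f r) < \<sigma> (f s) \<longleftrightarrow> [a, b, c] ! r < [a, b, c] ! s"
    unfolding contains_pattern_def by (auto simp: numeral_3_eq_3)
  have "f 0 < f 1" "f 1 < f 2"
    using f(2) by (auto simp: strict_mono_on_def)
  moreover have "1 \<le> f 0" "f 2 \<le> n"
    using f(1)[unfolded image_subset_iff, rule_format, of 0] f(1)[unfolded image_subset_iff, rule_format, of 2]
    by auto
  ultimately show ?R
    using f(3)[of 0 1] f(3)[of 1 0] f(3)[of 0 2] f(3)[of 2 0] f(3)[of 1 2] f(3)[of 2 1]
    by (intro exI[of _ "f 0"] exI[of _ "f 1"] exI[of _ "f 2"]) simp
next
  assume ?R
  then obtain x y z where xyz: "1 \<le> x" "x < y" "y < z" "z \<le> n"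
      "\<sigma> x < \<sigma> y \<longleftrightarrow> a < b" "\<sigma> y < \<sigma> x \<longleftrightarrow> b < a"
      "\<sigma> x < \<sigma> z \<longleftrightarrow> a < c" "\<sigma> z < \<sigma> x \<longleftrightarrow> c < a"
      "\<sigma> y < \<sigma> z \<longleftrightarrow> b < c" "\<sigma> z < \<sigma> y \<longleftrightarrow> c < b"
    by blast
  show ?L
    unfolding contains_pattern_def
  proof (intro exI[of _ "\<lambda>r. [x, y, z] ! r"] conjI)
    show "(!) [x, y, z] ` {..<length [a, b, c]} \<subseteq> {1..n}"
      using xyz(1-4) by (auto simp: less_Suc_eq numeral_2_eq_2)
    show "strict_mono_on {..<length [a, b, c]} ((!) [x, y, z])"
      using xyz(1-4) by (auto simp: strict_mono_on_def less_Suc_eq numeral_2_eq_2)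
    show "\<forall>r<length [a, b, c]. \<forall>s<length [a, b, c].
        \<sigma> ([x, y, z] ! r) < \<sigma> ([x, y, z] ! s) \<longleftrightarrow> [a, b, c] ! r < [a, b, c] ! s"
      using xyz(5-10) by (auto simp: less_Suc_eq numeral_2_eq_2)
  qed
qed

lemma permutes_neq:
  assumes "\<sigma> permutes A" "x \<noteq> y"
  shows "\<sigma> x \<noteq> \<sigma> y"
  using permutes_inj[OF assms(1)] assms(2) by (auto dest: injD)

lemma permutes_obtain:
  assumes "\<sigma> permutes {1..n}" "v \<in> {1..n}"
  obtains k where "k \<in> {1..n}" "\<sigma> k = (v :: nat)"
  using permutes_image[OF assms(1)] assms(2) by (metis imageE)

lemma permutes_range:
  assumes "\<sigma> permutes {1..n}" "1 \<le> x" "x \<le> (n :: nat)"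
  shows "1 \<le> \<sigma> x" "\<sigma> x \<le> n"
  using permutes_in_image[OF assms(1), of x] assms(2,3) by auto

text \<open>The patterns 123, 132, 312 are the three ways of inserting 3 into 12. An ascent avoiding
  the value \<open>n\<close> therefore forms one of them with \<open>n\<close>, depending on the
  position of \<open>n\<close>.\<close>

lemma S1_iff:
  "\<sigma> \<in> S1 n \<longleftrightarrow> \<sigma> permutes {1..n} \<and>
    (\<forall>x y. 1 \<le> x \<longrightarrow> x < y \<longrightarrow> y \<le> n \<longrightarrow> \<sigma> x \<noteq> n \<longrightarrow> \<sigma> y \<noteq> n \<longrightarrow> \<sigma> y < \<sigma> x)"
proof (intro iffI conjI allI impI)
  assume S: "\<sigma> \<in> S1 n"
  then show perm: "\<sigma> permutes {1..n}" by (simp add: S1_def avoiders_def)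
  fix x y assume xy: "1 \<le> x" "x < y" "y \<le> n" "\<sigma> x \<noteq> n" "\<sigma> y \<noteq> n"
  obtain k where k: "k \<in> {1..n}" "\<sigma> k = n"
    using permutes_obtain[OF perm, of n] xy by auto
  have lt: "\<sigma> x < \<sigma> k" "\<sigma> y < \<sigma> k"
    using permutes_range(2)[OF perm, of x] permutes_range(2)[OF perm, of y] xy k by auto
  show "\<sigma> y < \<sigma> x"
  proof (rule ccontr)
    assume "\<not> \<sigma> y < \<sigma> x"
    then have less: "\<sigma> x < \<sigma> y" using permutes_neq[OF perm, of x y] xy by simp
    consider "k < x" | "x < k" "k < y" | "y < k"
      using xy k by (metis nat_neq_iff)
    then have "contains_pattern n \<sigma> [3,1,2] \<or> contains_pattern n \<sigma> [1,3,2] \<or> contains_pattern n \<sigma> [1,2,3]"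
    proof cases
      case 1
      then have "contains_pattern n \<sigma> [3,1,2]"
        unfolding contains_pattern_triple using xy k lt less
        by (intro exI[of _ k] exI[of _ x] exI[of _ y]) auto
      then show ?thesis by simp
    next
      case 2
      then have "contains_pattern n \<sigma> [1,3,2]"
        unfolding contains_pattern_triple using xy k lt less
        by (intro exI[of _ x] exI[of _ k] exI[of _ y]) auto
      then show ?thesis by simp
    next
      case 3
      then have "contains_pattern n \<sigma> [1,2,3]"
        unfolding contains_pattern_triple using xy k lt less
        by (intro exI[of _ x] exI[of _ y] exI[of _ k]) auto
      then show ?thesis by simp
    qed
    then show False using S by (auto simp: S1_def avoiders_def)
  qed
next
  assume "\<sigma> permutes {1..n} \<and>
    (\<forall>x y. 1 \<le> x \<longrightarrow> x < y \<longrightarrow> y \<le> n \<longrightarrow> \<sigma> x \<noteq> n \<longrightarrow> \<sigma> y \<noteq> n \<longrightarrow> \<sigma> y < \<sigma> x)"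
  then have perm: "\<sigma> permutes {1..n}"
    and dec: "\<And>x y. 1 \<le> x \<Longrightarrow> x < y \<Longrightarrow> y \<le> n \<Longrightarrow> \<sigma> x \<noteq> n \<Longrightarrow> \<sigma> y \<noteq> n \<Longrightarrow> \<sigma> y < \<sigma> x"
    by auto
  have False if "contains_pattern n \<sigma> \<tau>" "\<tau> \<in> {[1,2,3], [1,3,2], [3,1,2]}" for \<tau>
  proof -
    \<comment> \<open>In each pattern the two smaller entries form an ascent, and neither equals
      \<open>n\<close> because a larger entry is present.\<close>
    from that obtain x y z where "1 \<le> x" "x < y" "y < z" "z \<le> n"
      "\<sigma> x < \<sigma> y \<and> \<sigma> y < \<sigma> z \<or> \<sigma> x < \<sigma> z \<and> \<sigma> z < \<sigma> y \<or> \<sigma> y < \<sigma> z \<and> \<sigma> z < \<sigma> x"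
      by (auto simp: contains_pattern_triple)
    moreover from this have "\<sigma> x \<le> n" "\<sigma> y \<le> n" "\<sigma> z \<le> n"
      using permutes_range(2)[OF perm] by auto
    ultimately show False
      using dec[of x y] dec[of x z] dec[of y z] by auto
  qed
  then show "\<sigma> \<in> S1 n"
    using perm by (auto simp: S1_def avoiders_def)
qed

text \<open>Dual to \<open>S1_iff\<close>: 123, 213, 231 are the three ways of inserting 1 into 23,
  so the value 1 completes every ascent that avoids it.\<close>

lemma S2_iff:
  "\<sigma> \<in> S2 n \<longleftrightarrow> \<sigma> permutes {1..n} \<and>
    (\<forall>x y. 1 \<le> x \<longrightarrow> x < y \<longrightarrow> y \<le> n \<longrightarrow> \<sigma> x \<noteq> 1 \<longrightarrow> \<sigma> y \<noteq> 1 \<longrightarrow> \<sigma> y < \<sigma> x)"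
proof (intro iffI conjI allI impI)
  assume S: "\<sigma> \<in> S2 n"
  then show perm: "\<sigma> permutes {1..n}" by (simp add: S2_def avoiders_def)
  fix x y assume xy: "1 \<le> x" "x < y" "y \<le> n" "\<sigma> x \<noteq> 1" "\<sigma> y \<noteq> 1"
  obtain k where k: "k \<in> {1..n}" "\<sigma> k = 1"
    using permutes_obtain[OF perm, of 1] xy by auto
  have lt: "\<sigma> k < \<sigma> x" "\<sigma> k < \<sigma> y"
    using permutes_range(1)[OF perm, of x] permutes_range(1)[OF perm, of y] xy k by auto
  show "\<sigma> y < \<sigma> x"
  proof (rule ccontr)
    assume "\<not> \<sigma> y < \<sigma> x"
    then have less: "\<sigma> x < \<sigma> y" using permutes_neq[OF perm, of x y] xy by simp
    consider "k < x" | "x < k" "k < y" | "y < k"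
      using xy k by (metis nat_neq_iff)
    then have "contains_pattern n \<sigma> [1,2,3] \<or> contains_pattern n \<sigma> [2,1,3] \<or> contains_pattern n \<sigma> [2,3,1]"
    proof cases
      case 1
      then have "contains_pattern n \<sigma> [1,2,3]"
        unfolding contains_pattern_triple using xy k lt less
        by (intro exI[of _ k] exI[of _ x] exI[of _ y]) auto
      then show ?thesis by simp
    next
      case 2
      then have "contains_pattern n \<sigma> [2,1,3]"
        unfolding contains_pattern_triple using xy k lt less
        by (intro exI[of _ x] exI[of _ k] exI[of _ y]) auto
      then show ?thesis by simp
    next
      case 3
      then have "contains_pattern n \<sigma> [2,3,1]"
        unfolding contains_pattern_triple using xy k lt less
        by (intro exI[of _ x] exI[of _ y] exI[of _ k]) auto
      then show ?thesis by simp
    qed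
    then show False using S by (auto simp: S2_def avoiders_def)
  qed
next
  assume "\<sigma> permutes {1..n} \<and>
    (\<forall>x y. 1 \<le> x \<longrightarrow> x < y \<longrightarrow> y \<le> n \<longrightarrow> \<sigma> x \<noteq> 1 \<longrightarrow> \<sigma> y \<noteq> 1 \<longrightarrow> \<sigma> y < \<sigma> x)"
  then have perm: "\<sigma> permutes {1..n}"
    and dec: "\<And>x y. 1 \<le> x \<Longrightarrow> x < y \<Longrightarrow> y \<le> n \<Longrightarrow> \<sigma> x \<noteq> 1 \<Longrightarrow> \<sigma> y \<noteq> 1 \<Longrightarrow> \<sigma> y < \<sigma> x"
    by auto
  have False if "contains_pattern n \<sigma> \<tau>" "\<tau> \<in> {[1,2,3], [2,1,3], [2,3,1]}" for \<tau>
  proof -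
    \<comment> \<open>The two larger entries form an ascent and exceed 1.\<close>
    from that obtain x y z where "1 \<le> x" "x < y" "y < z" "z \<le> n"
      "\<sigma> x < \<sigma> y \<and> \<sigma> y < \<sigma> z \<or> \<sigma> y < \<sigma> x \<and> \<sigma> x < \<sigma> z \<or> \<sigma> z < \<sigma> x \<and> \<sigma> x < \<sigma> y"
      by (auto simp: contains_pattern_triple)
    moreover from this have "1 \<le> \<sigma> x" "1 \<le> \<sigma> y" "1 \<le> \<sigma> z"
      using permutes_range(1)[OF perm] by auto
    ultimately show False
      using dec[of x y] dec[of x z] dec[of y z] by auto
  qed
  then show "\<sigma> \<in> S2 n"
    using perm by (auto simp: S2_def avoiders_def)
qed

text \<open>With the value 1 at \<open>k\<close>, a descent after \<open>k\<close> gives 132, an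
  ascent around \<open>k\<close> gives 213, and an ascent before \<open>k\<close> gives 231. So the
  comparison of two entries is decided by the left position alone.\<close>

lemma S3_iff:
  assumes k: "k \<in> {1..n}" "\<sigma> k = 1"
  shows "\<sigma> \<in> S3 n \<longleftrightarrow> \<sigma> permutes {1..n} \<and>
    (\<forall>x y. 1 \<le> x \<longrightarrow> x < y \<longrightarrow> y \<le> n \<longrightarrow> (\<sigma> y < \<sigma> x \<longleftrightarrow> x < k))"
proof (rule iffI, intro conjI allI impI)
  assume S: "\<sigma> \<in> S3 n"
  then show perm: "\<sigma> permutes {1..n}" by (simp add: S3_def avoiders_def)
  fix x y assume xy: "1 \<le> x" "x < y" "y \<le> n"
  have lt: "\<sigma> k < \<sigma> z" if "1 \<le> z" "z \<le> n" "z \<noteq> k" for z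
    using permutes_range(1)[OF perm, of z] permutes_neq[OF perm, of z k] that k by auto
  have ne: "\<sigma> x \<noteq> \<sigma> y" using permutes_neq[OF perm, of x y] xy by simp
  have avoid: "\<not> contains_pattern n \<sigma> [1,3,2]" "\<not> contains_pattern n \<sigma> [2,1,3]" "\<not> contains_pattern n \<sigma> [2,3,1]"
    using S by (auto simp: S3_def avoiders_def)
  consider "x = k" | "y = k" | "k < x" | "x < k" "k < y" | "y < k"
    by (metis nat_neq_iff)
  then show "\<sigma> y < \<sigma> x \<longleftrightarrow> x < k"
  proof cases
    case 1
    then show ?thesis using lt[of y] xy by auto
  next
    case 2
    then show ?thesis using lt[of x] xy by auto
  next
    case 3
    have "contains_pattern n \<sigma> [1,3,2]" if "\<sigma> y < \<sigma> x"
      unfolding contains_pattern_triple using xy k lt[of x] lt[of y] that 3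
      by (intro exI[of _ k] exI[of _ x] exI[of _ y]) auto
    then show ?thesis using avoid(1) 3 by auto
  next
    case 4
    have "contains_pattern n \<sigma> [2,1,3]" if "\<sigma> x < \<sigma> y"
      unfolding contains_pattern_triple using xy k lt[of x] lt[of y] that 4
      by (intro exI[of _ x] exI[of _ k] exI[of _ y]) auto
    then show ?thesis using avoid(2) 4 ne by (meson nat_neq_iff)
  next
    case 5
    have "contains_pattern n \<sigma> [2,3,1]" if "\<sigma> x < \<sigma> y"
      unfolding contains_pattern_triple using xy k lt[of x] lt[of y] that 5
      by (intro exI[of _ x] exI[of _ y] exI[of _ k]) auto
    then show ?thesis using avoid(3) 5 xy ne by (meson nat_neq_iff less_trans)
  qed
next
  assume "\<sigma> permutes {1..n} \<and>
    (\<forall>x y. 1 \<le> x \<longrightarrow> x < y \<longrightarrow> y \<le> n \<longrightarrow> (\<sigma> y < \<sigma> x \<longleftrightarrow> x < k))"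
  then have perm: "\<sigma> permutes {1..n}"
    and rel: "\<And>x y. 1 \<le> x \<Longrightarrow> x < y \<Longrightarrow> y \<le> n \<Longrightarrow> \<sigma> y < \<sigma> x \<longleftrightarrow> x < k"
    by auto
  have False if "contains_pattern n \<sigma> \<tau>" "\<tau> \<in> {[1,3,2], [2,1,3], [2,3,1]}" for \<tau>
  proof -
    \<comment> \<open>In 213 and 231 the first entry has both a smaller and a larger entry to its
      right. In 132 the ascent at \<open>x\<close> forces \<open>k \<le> x\<close>, which rules out
      the descent at \<open>y > x\<close>.\<close>
    from that obtain x y z where "1 \<le> x" "x < y" "y < z" "z \<le> n"
      "\<sigma> x < \<sigma> z \<and> \<sigma> z < \<sigma> y \<or> \<sigma> y < \<sigma> x \<and> \<sigma> x < \<sigma> z \<or> \<sigma> z < \<sigma> x \<and> \<sigma> x < \<sigma> y"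
      by (auto simp: contains_pattern_triple)
    then show False
      using rel[of x y] rel[of x z] rel[of y z] by auto
  qed
  then show "\<sigma> \<in> S3 n"
    using perm by (auto simp: S3_def avoiders_def)
qed

section \<open>Standard exponents of the three classes as unions of boxes\<close>

lemma S_permutes:
  "\<sigma> \<in> S1 n \<Longrightarrow> \<sigma> permutes {1..n}" "\<sigma> \<in> S2 n \<Longrightarrow> \<sigma> permutes {1..n}" "\<sigma> \<in> S3 n \<Longrightarrow> \<sigma> permutes {1..n}"
  by (simp_all add: S1_def S2_def S3_def avoiders_def)

text \<open>Reads the bound \<open>n - \<sigma> t\<close> off the shape of \<open>\<sigma>\<close>:
  each value above \<open>\<sigma> t\<close> is taken exactly once.\<close>

lemma permutes_card_greater:
  assumes perm: "\<sigma> permutes {1..n}" and t: "t \<in> {1..n}"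
  shows "n - \<sigma> t = card {s \<in> {1..n}. \<sigma> t < (\<sigma> s :: nat)}"
proof -
  have "\<sigma> ` {s \<in> {1..n}. \<sigma> t < \<sigma> s} = {\<sigma> t<..n}"
  proof (intro equalityI subsetI)
    fix v assume "v \<in> {\<sigma> t<..n}"
    then have "v \<in> {1..n}" by auto
    then obtain s where "s \<in> {1..n}" "\<sigma> s = v" using permutes_obtain[OF perm] by blast
    then show "v \<in> \<sigma> ` {s \<in> {1..n}. \<sigma> t < \<sigma> s}" using \<open>v \<in> {\<sigma> t<..n}\<close> by auto
  qed (use permutes_range(2)[OF perm] in auto)
  then have "card {\<sigma> t<..n} = card {s \<in> {1..n}. \<sigma> t < \<sigma> s}"
    using card_image[OF inj_on_subset[OF permutes_inj[OF perm] subset_UNIV]] by metis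
  then show ?thesis by simp
qed

text \<open>Builds a permutation from a prescribed vector of bounds
  \<open>\<tau> = n - \<sigma>\<close>; an injective self-map of a finite set is bijective.\<close>

lemma complement_permutes:
  assumes inj: "inj_on \<tau> {1..n}" and range: "\<And>t. t \<in> {1..n} \<Longrightarrow> \<tau> t < n"
  shows "(\<lambda>t. if t \<in> {1..n} then n - \<tau> t else t) permutes {1..n :: nat}" (is "?\<sigma> permutes _")
proof (rule bij_imp_permutes)
  have maps: "?\<sigma> ` {1..n} \<subseteq> {1..n}"
  proof (intro image_subsetI)
    fix t assume t: "t \<in> {1..n}"
    from range[OF t] t show "?\<sigma> t \<in> {1..n}" by simp
  qed
  have "inj_on ?\<sigma> {1..n}"
  proof (rule inj_onI)
    fix x y assume xy: "x \<in> {1..n}" "y \<in> {1..n}" "?\<sigma> x = ?\<sigma> y"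
    then have "\<tau> x = \<tau> y" using range[OF xy(1)] range[OF xy(2)] by simp
    then show "x = y" by (rule inj_onD[OF inj _ xy(1,2)])
  qed
  then show "bij_betw ?\<sigma> {1..n} {1..n}"
    unfolding bij_betw_def using endo_inj_surj[OF finite_atLeastAtMost maps] by blast
qed (simp only: if_False)

text \<open>It suffices that the bound vectors \<open>n - \<sigma>\<close> and the vectors
  \<open>\<tau> k\<close> are the same family; no bijection between \<open>S\<close> and the
  positions is required.\<close>

lemma standard_exps_eqI:
  assumes perm: "\<And>\<sigma>. \<sigma> \<in> S \<Longrightarrow> \<sigma> permutes {1..n}"
    and "\<And>\<sigma>. \<sigma> \<in> S \<Longrightarrow> \<exists>k\<in>{1..n}. \<forall>t\<in>{1..n}. n - \<sigma> t = \<tau> k t"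
    and "\<And>k. k \<in> {1..n} \<Longrightarrow> \<exists>\<sigma>\<in>S. \<forall>t\<in>{1..n}. n - \<sigma> t = \<tau> k t"
  shows "standard_exps n S = {p \<in> {1..n} \<rightarrow>\<^sub>E UNIV. \<exists>k\<in>{1..n}. \<forall>t\<in>{1..n}. p t \<le> \<tau> k t}"
proof -
  have "p t + \<sigma> t \<le> n \<longleftrightarrow> p t \<le> n - \<sigma> t" if "\<sigma> \<in> S" "t \<in> {1..n}" for p :: "nat \<Rightarrow> nat" and \<sigma> t
    using permutes_range(2)[OF perm[OF that(1)], of t] that(2) by auto
  then have "standard_exps n S = {p \<in> {1..n} \<rightarrow>\<^sub>E UNIV. \<exists>\<sigma>\<in>S. \<forall>t\<in>{1..n}. p t \<le> n - \<sigma> t}"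
    unfolding standard_exps_def by (simp only: cong: bex_cong ball_cong)
  also have "\<dots> = {p \<in> {1..n} \<rightarrow>\<^sub>E UNIV. \<exists>k\<in>{1..n}. \<forall>t\<in>{1..n}. p t \<le> \<tau> k t}"
  proof (intro Collect_cong conj_cong refl iffI)
    fix p :: "nat \<Rightarrow> nat"
    assume "\<exists>\<sigma>\<in>S. \<forall>t\<in>{1..n}. p t \<le> n - \<sigma> t"
    then obtain \<sigma> where "\<sigma> \<in> S" "\<forall>t\<in>{1..n}. p t \<le> n - \<sigma> t" by blast
    then show "\<exists>k\<in>{1..n}. \<forall>t\<in>{1..n}. p t \<le> \<tau> k t"
      using assms(2)[of \<sigma>] by metis
  next
    fix p :: "nat \<Rightarrow> nat"
    assume "\<exists>k\<in>{1..n}. \<forall>t\<in>{1..n}. p t \<le> \<tau> k t"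
    then obtain k where "k \<in> {1..n}" "\<forall>t\<in>{1..n}. p t \<le> \<tau> k t" by blast
    then show "\<exists>\<sigma>\<in>S. \<forall>t\<in>{1..n}. p t \<le> n - \<sigma> t"
      using assms(3)[of k] by metis
  qed
  finally show ?thesis .
qed

text \<open>Let \<open>n\<close> stand at \<open>k\<close>. For \<open>t \<noteq> k\<close> the
  entries above \<open>\<sigma> t\<close> are those at earlier positions together with the one at
  \<open>k\<close>, hence \<open>t\<close> of them if \<open>t < k\<close> and \<open>t - 1\<close>
  otherwise.\<close>

lemma standard_exps_S1:
  assumes "n \<ge> 1"
  shows "standard_exps n (S1 n) = {p \<in> {1..n} \<rightarrow>\<^sub>E UNIV. \<exists>k\<in>{1..n}. \<forall>t\<in>{1..n}.
    p t \<le> (if t < k then t else if t = k then 0 else t - 1)}"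
proof (rule standard_exps_eqI)
  fix \<sigma> assume \<sigma>: "\<sigma> \<in> S1 n"
  then show perm: "\<sigma> permutes {1..n}" by (simp add: S1_iff)
  obtain k where k: "k \<in> {1..n}" "\<sigma> k = n"
    using permutes_obtain[OF perm, of n] assms by auto
  have dec: "\<sigma> y < \<sigma> x" if "1 \<le> x" "x < y" "y \<le> n" "x \<noteq> k" "y \<noteq> k" for x y
    using \<sigma> permutes_neq[OF perm, of x k] permutes_neq[OF perm, of y k] that k(2) by (auto simp: S1_iff)
  show "\<exists>k\<in>{1..n}. \<forall>t\<in>{1..n}. n - \<sigma> t = (if t < k then t else if t = k then 0 else t - 1)"
  proof (intro bexI[OF _ k(1)] ballI)
    fix t assume t: "t \<in> {1..n}"
    show "n - \<sigma> t = (if t < k then t else if t = k then 0 else t - 1)"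
    proof (cases "t = k")
      case False
      have lt: "\<sigma> t < n"
        using permutes_range(2)[OF perm, of t] permutes_neq[OF perm False] k t by auto
      have "{s \<in> {1..n}. \<sigma> t < \<sigma> s} = insert k {1..<t}"
      proof (intro equalityI subsetI)
        fix s assume s: "s \<in> {s \<in> {1..n}. \<sigma> t < \<sigma> s}"
        then show "s \<in> insert k {1..<t}"
          using dec[of t s] t False by (cases "s < t"; cases "s = t"; cases "s = k") auto
      next
        fix s assume s: "s \<in> insert k {1..<t}"
        then show "s \<in> {s \<in> {1..n}. \<sigma> t < \<sigma> s}"
          using dec[of s t] t False lt k by (cases "s = k") auto
      qed
      then have "n - \<sigma> t = card (insert k {1..<t})"
        by (simp only: permutes_card_greater[OF perm t])
      also have "\<dots> = (if t < k then t else t - 1)"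
        using False k(1) t by (simp add: card_insert_if)
      finally show ?thesis using False by simp
    qed (use k in simp)
  qed
next
  fix k assume k: "k \<in> {1..n}"
  \<comment> \<open>The bounds \<open>1, ..., k - 1, 0, k, ..., n - 1\<close> are distinct and below
    \<open>n\<close>, so their complement is a permutation.\<close>
  let ?\<tau> = "\<lambda>t. if t < k then t else if t = k then 0 else t - 1"
  have perm: "(\<lambda>t. if t \<in> {1..n} then n - ?\<tau> t else t) permutes {1..n}" (is "?\<sigma> permutes _")
  proof (rule complement_permutes)
    show "inj_on ?\<tau> {1..n}"
    proof (rule inj_onI)
      fix x y assume "x \<in> {1..n}" "y \<in> {1..n}" "?\<tau> x = ?\<tau> y"
      then show "x = y"
        using k by (cases x k rule: linorder_cases; cases y k rule: linorder_cases) auto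
    qed
    show "?\<tau> t < n" if "t \<in> {1..n}" for t
      using that k by (cases t k rule: linorder_cases) auto
  qed
  have "?\<sigma> \<in> S1 n"
    unfolding S1_iff
  proof (intro conjI allI impI perm)
    fix x y assume xy: "1 \<le> x" "x < y" "y \<le> n" "?\<sigma> x \<noteq> n" "?\<sigma> y \<noteq> n"
    then have "x \<noteq> k" "y \<noteq> k" using k by auto
    then show "?\<sigma> y < ?\<sigma> x"
      using xy(1-3) k by (cases x k rule: linorder_cases; cases y k rule: linorder_cases) auto
  qed
  then show "\<exists>\<sigma>\<in>S1 n. \<forall>t\<in>{1..n}. n - \<sigma> t = ?\<tau> t"
  proof (rule bexI[rotated], intro ballI)
    fix t assume "t \<in> {1..n}"
    then show "n - ?\<sigma> t = ?\<tau> t"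
      using k by (cases t k rule: linorder_cases) auto
  qed
qed

text \<open>Let 1 stand at \<open>k\<close>. For \<open>t \<noteq> k\<close> the entries above
  \<open>\<sigma> t\<close> are those at earlier positions other than \<open>k\<close>; at
  \<open>t = k\<close> all other entries are larger.\<close>

lemma standard_exps_S2:
  assumes "n \<ge> 1"
  shows "standard_exps n (S2 n) = {p \<in> {1..n} \<rightarrow>\<^sub>E UNIV. \<exists>k\<in>{1..n}. \<forall>t\<in>{1..n}.
    p t \<le> (if t < k then t - 1 else if t = k then n - 1 else t - 2)}"
proof (rule standard_exps_eqI)
  fix \<sigma> assume \<sigma>: "\<sigma> \<in> S2 n"
  then show perm: "\<sigma> permutes {1..n}" by (simp add: S2_iff)
  obtain k where k: "k \<in> {1..n}" "\<sigma> k = 1"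
    using permutes_obtain[OF perm, of 1] assms by auto
  have dec: "\<sigma> y < \<sigma> x" if "1 \<le> x" "x < y" "y \<le> n" "x \<noteq> k" "y \<noteq> k" for x y
    using \<sigma> permutes_neq[OF perm, of x k] permutes_neq[OF perm, of y k] that k(2) by (auto simp: S2_iff)
  show "\<exists>k\<in>{1..n}. \<forall>t\<in>{1..n}. n - \<sigma> t = (if t < k then t - 1 else if t = k then n - 1 else t - 2)"
  proof (intro bexI[OF _ k(1)] ballI)
    fix t assume t: "t \<in> {1..n}"
    show "n - \<sigma> t = (if t < k then t - 1 else if t = k then n - 1 else t - 2)"
    proof (cases "t = k")
      case False
      have "{s \<in> {1..n}. \<sigma> t < \<sigma> s} = {1..<t} - {k}"
      proof (intro equalityI subsetI)
        fix s assume s: "s \<in> {s \<in> {1..n}. \<sigma> t < \<sigma> s}"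
        then show "s \<in> {1..<t} - {k}"
          using dec[of t s] t False k permutes_range(1)[OF perm, of t]
          by (cases "s < t"; cases "s = t"; cases "s = k") auto
      next
        fix s assume s: "s \<in> {1..<t} - {k}"
        then show "s \<in> {s \<in> {1..n}. \<sigma> t < \<sigma> s}"
          using dec[of s t] t False by auto
      qed
      then have "n - \<sigma> t = card ({1..<t} - {k})"
        by (simp only: permutes_card_greater[OF perm t])
      also have "\<dots> = (if t < k then t - 1 else t - 2)"
        using False k(1) t by (auto simp: card_Diff_singleton_if numeral_2_eq_2)
      finally show ?thesis using False by simp
    qed (use k in simp)
  qed
next
  fix k assume k: "k \<in> {1..n}"
  \<comment> \<open>The bounds are \<open>0, ..., k - 2\<close>, then \<open>n - 1\<close>, then
    \<open>k - 1, ..., n - 2\<close>.\<close>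
  let ?\<tau> = "\<lambda>t. if t < k then t - 1 else if t = k then n - 1 else t - 2"
  have perm: "(\<lambda>t. if t \<in> {1..n} then n - ?\<tau> t else t) permutes {1..n}" (is "?\<sigma> permutes _")
  proof (rule complement_permutes)
    show "inj_on ?\<tau> {1..n}"
    proof (rule inj_onI)
      fix x y assume "x \<in> {1..n}" "y \<in> {1..n}" "?\<tau> x = ?\<tau> y"
      then show "x = y"
        using k by (cases x k rule: linorder_cases; cases y k rule: linorder_cases) auto
    qed
    show "?\<tau> t < n" if "t \<in> {1..n}" for t
      using that k by (cases t k rule: linorder_cases) auto
  qed
  have "?\<sigma> \<in> S2 n"
    unfolding S2_iff
  proof (intro conjI allI impI perm)
    fix x y assume xy: "1 \<le> x" "x < y" "y \<le> n" "?\<sigma> x \<noteq> 1" "?\<sigma> y \<noteq> 1"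
    then have "x \<noteq> k" "y \<noteq> k" using k by auto
    then show "?\<sigma> y < ?\<sigma> x"
      using xy(1-3) k by (cases x k rule: linorder_cases; cases y k rule: linorder_cases) auto
  qed
  then show "\<exists>\<sigma>\<in>S2 n. \<forall>t\<in>{1..n}. n - \<sigma> t = ?\<tau> t"
  proof (rule bexI[rotated], intro ballI)
    fix t assume "t \<in> {1..n}"
    then show "n - ?\<sigma> t = ?\<tau> t"
      using k by (cases t k rule: linorder_cases) auto
  qed
qed

text \<open>Let 1 stand at \<open>k\<close>. For \<open>t < k\<close> the larger entries are those
  before \<open>t\<close>. For \<open>t \<ge> k\<close> they are the \<open>k - 1\<close> entries
  before \<open>k\<close> and the \<open>n - t\<close> entries after \<open>t\<close>.\<close>

lemma standard_exps_S3:
  assumes "n \<ge> 1"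
  shows "standard_exps n (S3 n) = {p \<in> {1..n} \<rightarrow>\<^sub>E UNIV. \<exists>k\<in>{1..n}. \<forall>t\<in>{1..n}.
    p t \<le> (if t < k then t - 1 else n - 1 - (t - k))}"
proof (rule standard_exps_eqI)
  fix \<sigma> assume \<sigma>: "\<sigma> \<in> S3 n"
  then show perm: "\<sigma> permutes {1..n}" by (rule S_permutes)
  obtain k where k: "k \<in> {1..n}" "\<sigma> k = 1"
    using permutes_obtain[OF perm, of 1] assms by auto
  have rel: "\<sigma> y < \<sigma> x \<longleftrightarrow> x < k" if "1 \<le> x" "x < y" "y \<le> n" for x y
    using \<sigma> that unfolding S3_iff[of k n \<sigma>, OF k] by blast
  show "\<exists>k\<in>{1..n}. \<forall>t\<in>{1..n}. n - \<sigma> t = (if t < k then t - 1 else n - 1 - (t - k))"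
  proof (intro bexI[OF _ k(1)] ballI)
    fix t assume t: "t \<in> {1..n}"
    have "\<sigma> t < \<sigma> s \<longleftrightarrow> s < t \<and> s < k \<or> t < s \<and> k \<le> t" if "s \<in> {1..n}" for s
      using rel[of s t] rel[of t s] that t permutes_neq[OF perm, of s t]
      by (cases s t rule: linorder_cases) auto
    then have eq: "{s \<in> {1..n}. \<sigma> t < \<sigma> s} = (if t < k then {1..<t} else {1..<k} \<union> {t<..n})"
      using t k(1) by auto
    show "n - \<sigma> t = (if t < k then t - 1 else n - 1 - (t - k))"
    proof (cases "t < k")
      case False
      have "card ({1..<k} \<union> {t<..n}) = (k - 1) + (n - t)"
        using False by (subst card_Un_disjoint) auto
      then show ?thesis
        unfolding permutes_card_greater[OF perm t] eq using False t k(1) by simp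
    qed (simp only: permutes_card_greater[OF perm t] eq if_True card_atLeastLessThan)
  qed
next
  fix k assume k: "k \<in> {1..n}"
  \<comment> \<open>The bounds are \<open>0, ..., k - 2\<close>, followed by \<open>n - 1\<close>
    down to \<open>k - 1\<close>.\<close>
  let ?\<tau> = "\<lambda>t. if t < k then t - 1 else n - 1 - (t - k)"
  have perm: "(\<lambda>t. if t \<in> {1..n} then n - ?\<tau> t else t) permutes {1..n}" (is "?\<sigma> permutes _")
  proof (rule complement_permutes)
    show "inj_on ?\<tau> {1..n}"
    proof (rule inj_onI)
      fix x y assume "x \<in> {1..n}" "y \<in> {1..n}" "?\<tau> x = ?\<tau> y"
      then show "x = y"
        using k by (cases x k rule: linorder_cases; cases y k rule: linorder_cases) auto
    qed
    show "?\<tau> t < n" if "t \<in> {1..n}" for t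
      using that k by (cases t k rule: linorder_cases) auto
  qed
  have "?\<sigma> k = 1" using k by auto
  have "?\<sigma> \<in> S3 n"
    unfolding S3_iff[of k n ?\<sigma>, OF k \<open>?\<sigma> k = 1\<close>]
  proof (rule conjI[OF perm], intro allI impI)
    fix x y assume "1 \<le> x" "x < y" "y \<le> n"
    then show "?\<sigma> y < ?\<sigma> x \<longleftrightarrow> x < k"
      using k by (cases "x < k"; cases "y < k") auto
  qed
  then show "\<exists>\<sigma>\<in>S3 n. \<forall>t\<in>{1..n}. n - \<sigma> t = ?\<tau> t"
  proof (rule bexI[rotated], intro ballI)
    fix t assume "t \<in> {1..n}"
    then show "n - ?\<sigma> t = ?\<tau> t"
      using k by (cases t k rule: linorder_cases) auto
  qed
qed

subsection \<open>Parking functions\<close>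

text \<open>The entries below \<open>b\<close> form a prefix of a sorted list; were entry
  \<open>j\<close> not below \<open>b\<close>, that prefix would have length at most
  \<open>j\<close>.\<close>

lemma sorted_nth_less_if:
  fixes xs :: "'a::linorder list"
  assumes "sorted xs" "j < length (filter (\<lambda>x. x < b) xs)"
  shows "xs ! j < b"
proof (rule ccontr)
  assume "\<not> xs ! j < b"
  then have "{i. i < length xs \<and> xs ! i < b} \<subseteq> {..<j}"
    using sorted_nth_mono[OF assms(1)] by (auto simp: not_less) (meson leI order.strict_trans1 order.strict_trans2 less_irrefl)
  from card_mono[OF _ this] assms(2) show False
    by (simp add: length_filter_conv_card)
qed

lemma length_filter_sort: "length (filter P (sort xs)) = length (filter P xs)"
  by (metis mset_filter mset_sort size_mset)

text \<open>The parking condition says that at least \<open>j\<close> entries are below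
  \<open>j\<close>. The \<open>j\<close> positions where \<open>\<sigma>\<close> takes its top
  values \<open>n - j + 1, ..., n\<close> are such entries.\<close>

lemma PF_I:
  assumes p: "p \<in> {1..n} \<rightarrow>\<^sub>E UNIV" and perm: "\<sigma> permutes {1..n}"
    and le: "\<And>t. t \<in> {1..n} \<Longrightarrow> p t + \<sigma> t \<le> n"
  shows "p \<in> PF n"
  unfolding PF_def
proof (intro CollectI conjI ballI p)
  fix j assume j: "j \<in> {1..n}"
  have "j = card {n - j<..n}" using j by simp
  also have "\<dots> \<le> card (\<sigma> ` {t \<in> {1..n}. p t < j})"
  proof (rule card_mono)
    show "{n - j<..n} \<subseteq> \<sigma> ` {t \<in> {1..n}. p t < j}"
    proof
      fix v assume v: "v \<in> {n - j<..n}"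
      then have "v \<in> {1..n}" by auto
      then obtain t where t: "t \<in> {1..n}" "\<sigma> t = v" using permutes_obtain[OF perm] by blast
      then have "p t < j" using le[of t] v by auto
      then show "v \<in> \<sigma> ` {t \<in> {1..n}. p t < j}" using t by blast
    qed
  qed simp
  also have "\<dots> \<le> card {t \<in> {1..n}. p t < j}" by (rule card_image_le) simp
  also have "\<dots> = card (set (filter (\<lambda>t. p t < j) [1..<Suc n]))"
    by (rule arg_cong[of _ _ card]) auto
  also have "\<dots> = length (filter (\<lambda>x. x < j) (map p [1..<Suc n]))"
    by (subst distinct_card) (simp_all add: filter_map o_def del: upt_Suc)
  finally have "j \<le> length (filter (\<lambda>x. x < j) (sort (map p [1..<Suc n])))"
    by (simp only: length_filter_sort)
  then show "sort (map p [1..<Suc n]) ! (j - 1) < j"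
    using j by (intro sorted_nth_less_if) auto
qed

text \<open>The case \<open>j = n\<close> of the parking condition bounds the last sorted entry,
  hence all entries.\<close>

lemma PF_less:
  assumes p: "p \<in> PF n" and t: "t \<in> {1..n}"
  shows "p t < n"
proof -
  let ?xs = "sort (map p [1..<Suc n])"
  have "p t \<in> set ?xs" using t by (auto simp del: upt_Suc)
  then obtain i where "i < length ?xs" "p t = ?xs ! i"
    by (metis in_set_conv_nth)
  then have "p t \<le> ?xs ! (n - 1)"
    by (simp del: upt_Suc, intro sorted_nth_mono) (auto simp del: upt_Suc)
  also have "\<dots> < n" using p t by (auto simp: PF_def simp del: upt_Suc)
  finally show ?thesis .
qed

section \<open>Counting disjoint unions of boxes\<close>

lemma prod_split_at:
  fixes f g :: "nat \<Rightarrow> nat"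
  assumes "k \<in> {1..n}"
  shows "(\<Prod>t\<in>{1..n}. if t < k then f t else if t = k then c else g t)
    = (\<Prod>t\<in>{1..<k}. f t) * c * (\<Prod>t\<in>{k<..n}. g t)"
proof -
  have "{1..n} = insert k ({1..<k} \<union> {k<..n})" using assms by auto
  moreover have "(\<Prod>t\<in>{1..<k} \<union> {k<..n}. if t < k then f t else if t = k then c else g t)
      = (\<Prod>t\<in>{1..<k}. f t) * (\<Prod>t\<in>{k<..n}. g t)"
    by (subst prod.union_disjoint) (auto intro!: arg_cong2[where f = "(*)"] prod.cong)
  ultimately show ?thesis by simp
qed

text \<open>The product runs over \<open>k, ..., n - 1\<close> and completes \<open>(k - 1)!\<close>
  to \<open>(n - 1)!\<close>.\<close>

lemma prod_pred_greater:
  assumes "1 \<le> k" "k \<le> n"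
  shows "fact (k - 1) * (\<Prod>t\<in>{k<..n}. t - 1) = (fact (n - 1) :: nat)"
  using assms(2)
proof (induction n rule: dec_induct)
  case (step m)
  then have "{k<..Suc m} = insert (Suc m) {k<..m}" by auto
  moreover have "(fact m :: nat) = fact (m - 1) * m"
    using fact_reduce[where 'a = nat, of m] step assms(1) by simp
  ultimately show ?case using step by (simp add: algebra_simps)
qed simp

text \<open>Two boxes are disjoint as soon as one coordinate separates them.\<close>

lemma card_UN_boxes:
  assumes "finite I" "\<And>k t. k \<in> I \<Longrightarrow> t \<in> {1..n} \<Longrightarrow> finite (B k t)"
    and "\<And>k l. k \<in> I \<Longrightarrow> l \<in> I \<Longrightarrow> k < l \<Longrightarrow> \<exists>t\<in>{1..n}. B k t \<inter> B l t = {}"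
  shows "card (\<Union>k\<in>I. PiE {1..n} (B k)) = (\<Sum>k\<in>I. \<Prod>t\<in>{1..n}. card (B (k :: nat) (t :: nat)))"
proof (subst card_UN_disjoint)
  have "(PiE {1..n} (B k)) \<inter> (PiE {1..n} (B l)) = {}" if "k \<in> I" "l \<in> I" "k < l" for k l
    using assms(3)[OF that] by (auto dest!: PiE_mem)
  then show "\<forall>k\<in>I. \<forall>l\<in>I. k \<noteq> l \<longrightarrow> (PiE {1..n} (B k)) \<inter> (PiE {1..n} (B l)) = {}"
    by (metis inf_commute nat_neq_iff)
qed (use assms in \<open>auto simp: card_PiE intro!: finite_PiE\<close>)

text \<open>Box \<open>k\<close> collects the vectors whose last zero is at \<open>k\<close>. Its
  size is \<open>k! * (k * ... * (n - 1)) = k * (n - 1)!\<close>, and the \<open>k\<close> sum to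
  \<open>n * (n + 1) / 2\<close>.\<close>

lemma card_last_zero_boxes:
  assumes "n \<ge> 1"
  shows "2 * card (\<Union>k\<in>{1..n}. PiE {1..n}
    (\<lambda>t. if t < k then {0..t} else if t = k then {0} else {1..t - 1})) = fact (n + 1)"
proof -
  have "card (\<Union>k\<in>{1..n}. PiE {1..n}
      (\<lambda>t. if t < k then {0..t} else if t = k then {0} else {1..t - 1}))
      = (\<Sum>k\<in>{1..n}. \<Prod>t\<in>{1..n}. card (if t < k then {0..t} else if t = k then {0} else {1..t - 1}))"
  proof (rule card_UN_boxes)
    fix k l assume "k \<in> {1..n}" "l \<in> {1..n}" "k < l"
    then show "\<exists>t\<in>{1..n}. (if t < k then {0..t} else if t = k then {0} else {1..t - 1})
        \<inter> (if t < l then {0..t} else if t = l then {0} else {1..t - 1}) = {}"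
      \<comment> \<open>At coordinate \<open>l > k\<close>, box \<open>l\<close> requires 0 and box
        \<open>k\<close> forbids it.\<close>
      by (intro bexI[of _ l]) auto
  qed auto
  also have "\<dots> = (\<Sum>k\<in>{1..n}. k * fact (n - 1))"
  proof (rule sum.cong[OF refl])
    fix k assume k: "k \<in> {1..n}"
    have "(\<Prod>t\<in>{1..n}. card (if t < k then {0..t} else if t = k then {0} else {1..t - 1}))
        = (\<Prod>t\<in>{1..n}. if t < k then Suc t else if t = k then 1 else t - 1)"
      by (intro prod.cong) auto
    also have "\<dots> = (\<Prod>t\<in>{1..<k}. Suc t) * (\<Prod>t\<in>{k<..n}. t - 1)"
      by (simp only: prod_split_at[OF k] mult_1_right)
    also have "(\<Prod>t\<in>{1..<k}. Suc t) = k * fact (k - 1)"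
      using k by (cases k) (auto simp: fact_prod_Suc prod.atLeast_Suc_lessThan lessThan_atLeast0 numeral_eq_Suc)
    finally show "(\<Prod>t\<in>{1..n}. card (if t < k then {0..t} else if t = k then {0} else {1..t - 1})) = k * fact (n - 1)"
      using prod_pred_greater[of k n] k by (simp add: mult.assoc)
  qed
  also have "2 * \<dots> = 2 * (\<Sum>k\<in>{1..n}. k) * fact (n - 1)"
    by (simp add: sum_distrib_right)
  also have "2 * (\<Sum>k\<in>{1..n}. k) = n * (n + 1)"
    using gauss_sum_from_Suc_0[of n, where 'a = nat] by simp
  also have "n * (n + 1) * fact (n - 1) = fact (n + 1)"
    using assms by (cases n) (simp_all add: algebra_simps)
  finally show ?thesis .
qed

text \<open>Box \<open>k\<close> has its first \<open>t\<close> with \<open>p t \<ge> t\<close> at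
  \<open>k\<close>; the first set has no such \<open>t\<close>. Only the product of the bounds
  \<open>u k t\<close> after \<open>k\<close> affects the size, so one count serves both
  \<open>PF2\<close> and \<open>PF3\<close>. The total is
  \<open>n! + (n - 1)! * n * (n - 1) / 2\<close>; box \<open>n\<close> is empty.\<close>

lemma card_first_excedance_boxes:
  assumes "n \<ge> 1"
    and u: "\<And>k. k \<in> {1..n} \<Longrightarrow> (\<Prod>t\<in>{k<..n}. u k t) = (\<Prod>t\<in>{k<..n}. t - 1)"
  shows "2 * card ((PiE {1..n} (\<lambda>t. {0..<t})) \<union> (\<Union>k\<in>{1..n}. PiE {1..n}
    (\<lambda>t. if t < k then {0..<t} else if t = k then {k..<n} else {0..<u k t}))) = fact (n + 1)"
    (is "2 * card (?A \<union> ?U) = _")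
proof -
  have "card ?U = (\<Sum>k\<in>{1..n}. \<Prod>t\<in>{1..n}.
      card (if t < k then {0..<t} else if t = k then {k..<n} else {0..<u k t}))"
  proof (rule card_UN_boxes)
    fix k l assume "k \<in> {1..n}" "l \<in> {1..n}" "k < l"
    then show "\<exists>t\<in>{1..n}. (if t < k then {0..<t} else if t = k then {k..<n} else {0..<u k t})
        \<inter> (if t < l then {0..<t} else if t = l then {l..<n} else {0..<u l t}) = {}"
      \<comment> \<open>At coordinate \<open>k < l\<close>, box \<open>k\<close> requires a value at
        least \<open>k\<close> and box \<open>l\<close> a value below \<open>k\<close>.\<close>
      by (intro bexI[of _ k]) auto
  qed auto
  also have "\<dots> = (\<Sum>k\<in>{1..n}. (n - k) * fact (n - 1))"
  proof (rule sum.cong[OF refl])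
    fix k assume k: "k \<in> {1..n}"
    have "(\<Prod>t\<in>{1..n}. card (if t < k then {0..<t} else if t = k then {k..<n} else {0..<u k t}))
        = (\<Prod>t\<in>{1..n}. if t < k then t else if t = k then n - k else u k t)"
      by (intro prod.cong) auto
    also have "\<dots> = (\<Prod>t\<in>{1..<k}. t) * (n - k) * (\<Prod>t\<in>{k<..n}. t - 1)"
      by (simp only: prod_split_at[OF k] u[OF k])
    also have "(\<Prod>t\<in>{1..<k}. t) = fact (k - 1)"
      using k by (auto simp: fact_prod intro!: prod.cong)
    finally show "(\<Prod>t\<in>{1..n}. card (if t < k then {0..<t} else if t = k then {k..<n} else {0..<u k t}))
        = (n - k) * fact (n - 1)"
      using prod_pred_greater[of k n] k by (simp add: ac_simps)
  qed
  finally have U: "card ?U = (\<Sum>k\<in>{1..n}. n - k) * fact (n - 1)"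
    by (simp add: sum_distrib_right)
  have A: "card ?A = fact n"
    by (simp add: card_PiE fact_prod)
  have disj: "?A \<inter> ?U = {}"
  proof -
    have False if "p \<in> ?A" "k \<in> {1..n}" and "p \<in> PiE {1..n}
        (\<lambda>t. if t < k then {0..<t} else if t = k then {k..<n} else {0..<u k t})" for p k
      using PiE_mem[OF that(1,2)] PiE_mem[OF that(3,2)] by simp
    then show ?thesis by blast
  qed
  have fin: "finite ?A" "finite ?U"
    by (auto intro!: finite_PiE)
  have "(\<Sum>k\<in>{1..n}. n - k) = (\<Sum>k\<in>{0..n - 1}. k)"
    using assms(1) by (intro sum.reindex_bij_witness[of _ "\<lambda>k. n - k" "\<lambda>k. n - k"]) auto
  then have sum: "2 * (\<Sum>k\<in>{1..n}. n - k) = (n - 1) * n"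
    using gauss_sum_nat[of "n - 1"] assms(1) by (cases n) auto
  have "2 * card (?A \<union> ?U) = 2 * fact n + (n - 1) * n * fact (n - 1)"
    unfolding card_Un_disjoint[OF fin disj] U A by (simp only: sum[symmetric] distrib_left mult.assoc)
  also have "\<dots> = fact (n + 1)"
    using assms(1) by (cases n) (simp_all add: algebra_simps)
  finally show ?thesis .
qed

section \<open>Parking functions as standard exponents and as disjoint boxes\<close>

lemma standard_exps_subset_PF:
  assumes "\<And>\<sigma>. \<sigma> \<in> S \<Longrightarrow> \<sigma> permutes {1..n}"
  shows "standard_exps n S \<subseteq> PF n"
  using assms PF_I unfolding standard_exps_def by blast

text \<open>The cycle of inclusions \<open>PF1 n\<close>, disjoint boxes, standard exponents,
  \<open>PF1 n\<close> yields both equalities. The first inclusion cuts at the last zero.\<close>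

lemma PF1_eq:
  assumes n: "n \<ge> 1"
  shows "PF1 n = standard_exps n (S1 n)"
    and "PF1 n = (\<Union>k\<in>{1..n}. PiE {1..n}
      (\<lambda>t. if t < k then {0..t} else if t = k then {0} else {1..t - 1}))" (is "_ = ?B")
proof -
  have boxes: "?B \<subseteq> standard_exps n (S1 n)"
  proof
    fix p assume "p \<in> ?B"
    then obtain k where k: "k \<in> {1..n}" and p: "p \<in> PiE {1..n}
        (\<lambda>t. if t < k then {0..t} else if t = k then {0} else {1..t - 1})" by blast
    have "p t \<le> (if t < k then t else if t = k then 0 else t - 1)" if "t \<in> {1..n}" for t
      using PiE_mem[OF p that] by (auto split: if_splits)
    moreover have "p \<in> {1..n} \<rightarrow>\<^sub>E UNIV" using p by (auto simp: PiE_iff)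
    ultimately show "p \<in> standard_exps n (S1 n)"
      unfolding standard_exps_S1[OF n] using k by blast
  qed
  have std: "standard_exps n (S1 n) \<subseteq> PF1 n"
  proof
    fix p assume p: "p \<in> standard_exps n (S1 n)"
    then have "p \<in> PF n"
      using standard_exps_subset_PF[of "S1 n" n] S_permutes(1) by blast
    obtain k where k: "k \<in> {1..n}"
      and le: "\<And>t. t \<in> {1..n} \<Longrightarrow> p t \<le> (if t < k then t else if t = k then 0 else t - 1)"
      using p unfolding standard_exps_S1[OF n] by blast
    have "p t \<le> t" if "t \<in> {1..n}" for t
      using le[OF that] by (auto split: if_splits)
    \<comment> \<open>The bound reaches \<open>i\<close> only for \<open>i < k\<close>, and
      \<open>k\<close> is a zero of \<open>p\<close>.\<close>
    moreover have "\<exists>j\<in>{i..n}. p j = 0" if "i \<in> {1..n}" "p i = i" for i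
      using le[OF that(1)] le[OF k] that k by (intro bexI[of _ k]) (auto split: if_splits)
    ultimately show "p \<in> PF1 n"
      using \<open>p \<in> PF n\<close> unfolding PF1_def by blast
  qed
  have PF: "PF1 n \<subseteq> ?B"
  proof
    fix p assume p: "p \<in> PF1 n"
    then have ext: "p \<in> {1..n} \<rightarrow>\<^sub>E UNIV" and le: "\<And>t. t \<in> {1..n} \<Longrightarrow> p t \<le> t"
      and zero: "\<And>i. i \<in> {1..n} \<Longrightarrow> p i = i \<Longrightarrow> \<exists>j\<in>{i..n}. p j = 0"
      by (simp_all add: PF1_def PF_def)
    define Z where "Z = {j \<in> {1..n}. p j = 0}"
    \<comment> \<open>\<open>p 1\<close> is 0 or 1, and in the second case the condition at
      \<open>i = 1\<close> supplies a zero.\<close>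
    have "Z \<noteq> {}"
    proof (cases "p 1 = 0")
      case True
      then show ?thesis using n by (auto simp: Z_def)
    next
      case False
      then have "p 1 = 1" using le[of 1] n by simp
      then show ?thesis using zero[of 1] n by (auto simp: Z_def)
    qed
    define k where "k = Max Z"
    have fin: "finite Z" by (simp add: Z_def)
    have "k \<in> Z" unfolding k_def by (rule Max_in[OF fin \<open>Z \<noteq> {}\<close>])
    then have k: "k \<in> {1..n}" "p k = 0" by (auto simp: Z_def)
    have last: "p j \<noteq> 0" if "j \<in> {1..n}" "k < j" for j
    proof
      assume "p j = 0"
      then have "j \<in> Z" using that(1) by (simp add: Z_def)
      then have "j \<le> k" unfolding k_def by (rule Max_ge[OF fin])
      with that(2) show False by simp
    qed
    have "p t \<in> (if t < k then {0..t} else if t = k then {0} else {1..t - 1})" if t: "t \<in> {1..n}" for t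
    proof -
      \<comment> \<open>Equality would force a zero at or after \<open>t\<close>, beyond the last
        zero \<open>k\<close>.\<close>
      have "p t \<noteq> t" if "k < t"
      proof
        assume "p t = t"
        then obtain j where "j \<in> {t..n}" "p j = 0" using zero[OF t] by blast
        with last[of j] that t show False by simp
      qed
      then show ?thesis
        using le[OF t] k(2) last[OF t] by (cases t k rule: linorder_cases) auto
    qed
    then have "p \<in> PiE {1..n} (\<lambda>t. if t < k then {0..t} else if t = k then {0} else {1..t - 1})"
      using ext by (intro PiE_I) (auto dest: PiE_arb)
    then show "p \<in> ?B" using k(1) by blast
  qed
  show "PF1 n = standard_exps n (S1 n)"
    by (rule equalityI[OF subset_trans[OF PF boxes] std])
  show "PF1 n = ?B"
    by (rule equalityI[OF PF subset_trans[OF boxes std]])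
qed

text \<open>The box index is the least \<open>k\<close> with \<open>k \<le> p k\<close>; later
  coordinates are bounded by the defining condition at \<open>i = k\<close>, kept abstract as
  \<open>u\<close>.\<close>

lemma first_excedance_split:
  fixes p :: "nat \<Rightarrow> nat" and u :: "nat \<Rightarrow> nat \<Rightarrow> nat"
  assumes ext: "p \<in> {1..n} \<rightarrow>\<^sub>E UNIV"
    and less: "\<And>t. t \<in> {1..n} \<Longrightarrow> p t < n"
    and after: "\<And>i j. i \<in> {1..n} \<Longrightarrow> i \<le> p i \<Longrightarrow> j \<in> {i+1..n} \<Longrightarrow> p j < u i j"
  shows "p \<in> (PiE {1..n} (\<lambda>t. {0..<t})) \<union> (\<Union>k\<in>{1..n}. PiE {1..n}
    (\<lambda>t. if t < k then {0..<t} else if t = k then {k..<n} else {0..<u k t}))"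
proof (cases "\<exists>i\<in>{1..n}. i \<le> p i")
  case False
  have "p t \<in> {0..<t}" if "t \<in> {1..n}" for t
  proof -
    have "\<not> t \<le> p t" using False that by blast
    then show ?thesis by simp
  qed
  then have "p \<in> PiE {1..n} (\<lambda>t. {0..<t})"
    using ext by (intro PiE_I) (auto dest: PiE_arb)
  then show ?thesis by blast
next
  case True
  define k where "k = (LEAST i. i \<in> {1..n} \<and> i \<le> p i)"
  have k: "k \<in> {1..n}" "k \<le> p k"
    using LeastI_ex[of "\<lambda>i. i \<in> {1..n} \<and> i \<le> p i"] True unfolding k_def by blast+
  have first: "p t < t" if "t \<in> {1..n}" "t < k" for t
    using not_less_Least[of t "\<lambda>i. i \<in> {1..n} \<and> i \<le> p i"] that unfolding k_def by auto
  have "p t \<in> (if t < k then {0..<t} else if t = k then {k..<n} else {0..<u k t})" if t: "t \<in> {1..n}" for t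
    using first[OF t] after[OF k, of t] less[OF t] k t by (cases t k rule: linorder_cases) auto
  then have "p \<in> PiE {1..n} (\<lambda>t. if t < k then {0..<t} else if t = k then {k..<n} else {0..<u k t})"
    using ext by (intro PiE_I) (auto dest: PiE_arb)
  then show ?thesis using k(1) by blast
qed

text \<open>The same cycle of inclusions as in \<open>PF1_eq\<close>, now cut at the first
  excedance.\<close>

lemma PF2_eq:
  assumes n: "n \<ge> 1"
  shows "PF2 n = standard_exps n (S2 n)"
    and "PF2 n = (PiE {1..n} (\<lambda>t. {0..<t})) \<union> (\<Union>k\<in>{1..n}. PiE {1..n}
      (\<lambda>t. if t < k then {0..<t} else if t = k then {k..<n} else {0..<t - 1}))" (is "_ = ?A \<union> ?B")
proof -
  have boxes: "?A \<union> ?B \<subseteq> standard_exps n (S2 n)"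
  proof
    fix p assume "p \<in> ?A \<union> ?B"
    then consider "p \<in> ?A" | k where "k \<in> {1..n}" "p \<in> PiE {1..n}
        (\<lambda>t. if t < k then {0..<t} else if t = k then {k..<n} else {0..<t - 1})" by blast
    then obtain k where "k \<in> {1..n}" "p \<in> {1..n} \<rightarrow>\<^sub>E UNIV"
      "\<And>t. t \<in> {1..n} \<Longrightarrow> p t \<le> (if t < k then t - 1 else if t = k then n - 1 else t - 2)"
    proof cases
      case 1
      \<comment> \<open>For \<open>k = n\<close> every bound is \<open>t - 1\<close>, so this
        standard box takes in the vectors without excedance.\<close>
      have "p t \<le> (if t < n then t - 1 else if t = n then n - 1 else t - 2)" if "t \<in> {1..n}" for t
        using PiE_mem[OF 1 that] that by auto
      then show ?thesis using that[of n] 1 n by (auto simp: PiE_iff)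
    next
      case (2 k)
      have "p t \<le> (if t < k then t - 1 else if t = k then n - 1 else t - 2)" if "t \<in> {1..n}" for t
        using PiE_mem[OF 2(2) that] by (auto split: if_splits)
      then show ?thesis using that[of k] 2 by (auto simp: PiE_iff)
    qed
    then show "p \<in> standard_exps n (S2 n)"
      unfolding standard_exps_S2[OF n] by blast
  qed
  have std: "standard_exps n (S2 n) \<subseteq> PF2 n"
  proof
    fix p assume p: "p \<in> standard_exps n (S2 n)"
    then have "p \<in> PF n"
      using standard_exps_subset_PF[of "S2 n" n] S_permutes(2) by blast
    obtain k where k: "k \<in> {1..n}"
      and le: "\<And>t. t \<in> {1..n} \<Longrightarrow> p t \<le> (if t < k then t - 1 else if t = k then n - 1 else t - 2)"
      using p unfolding standard_exps_S2[OF n] by blast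
    have "p j < j - 1" if "i \<in> {1..n}" "i \<le> p i" "j \<in> {i+1..n}" for i j
    proof -
      \<comment> \<open>The bounds \<open>t - 1\<close> and \<open>t - 2\<close> stay below
        \<open>t\<close>, so an excedance can only sit at \<open>k\<close>. Then
        \<open>p j \<le> j - 2 < j - 1\<close>, as \<open>j \<ge> 2\<close>.\<close>
      have "i = k" using le[OF that(1)] that(1,2) by (auto split: if_splits)
      then show ?thesis using le[of j] that by auto
    qed
    then show "p \<in> PF2 n"
      using \<open>p \<in> PF n\<close> unfolding PF2_def by blast
  qed
  have PF: "PF2 n \<subseteq> ?A \<union> ?B"
  proof
    fix p assume p: "p \<in> PF2 n"
    then have PF: "p \<in> PF n" by (simp add: PF2_def)
    show "p \<in> ?A \<union> ?B"
    proof (rule first_excedance_split)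
      show "p \<in> {1..n} \<rightarrow>\<^sub>E UNIV" using PF by (simp add: PF_def)
      show "p t < n" if "t \<in> {1..n}" for t using PF_less[OF PF that] .
      show "p j < j - 1" if "i \<in> {1..n}" "i \<le> p i" "j \<in> {i+1..n}" for i j
        using p that unfolding PF2_def by blast
    qed
  qed
  show "PF2 n = standard_exps n (S2 n)"
    by (rule equalityI[OF subset_trans[OF PF boxes] std])
  show "PF2 n = ?A \<union> ?B"
    by (rule equalityI[OF PF subset_trans[OF boxes std]])
qed

text \<open>The cycle of \<open>PF2_eq\<close> again; vectors without excedance lie in the standard
  box \<open>k = n\<close>.\<close>

lemma PF3_eq:
  assumes n: "n \<ge> 1"
  shows "PF3 n = standard_exps n (S3 n)"
    and "PF3 n = (PiE {1..n} (\<lambda>t. {0..<t})) \<union> (\<Union>k\<in>{1..n}. PiE {1..n}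
      (\<lambda>t. if t < k then {0..<t} else if t = k then {k..<n} else {0..<n - (t - k)}))" (is "_ = ?A \<union> ?B")
proof -
  have boxes: "?A \<union> ?B \<subseteq> standard_exps n (S3 n)"
  proof
    fix p assume "p \<in> ?A \<union> ?B"
    then consider "p \<in> ?A" | k where "k \<in> {1..n}" "p \<in> PiE {1..n}
        (\<lambda>t. if t < k then {0..<t} else if t = k then {k..<n} else {0..<n - (t - k)})" by blast
    then obtain k where "k \<in> {1..n}" "p \<in> {1..n} \<rightarrow>\<^sub>E UNIV"
      "\<And>t. t \<in> {1..n} \<Longrightarrow> p t \<le> (if t < k then t - 1 else n - 1 - (t - k))"
    proof cases
      case 1
      have "p t \<le> (if t < n then t - 1 else n - 1 - (t - n))" if "t \<in> {1..n}" for t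
        using PiE_mem[OF 1 that] that by auto
      then show ?thesis using that[of n] 1 n by (auto simp: PiE_iff)
    next
      case (2 k)
      have "p t \<le> (if t < k then t - 1 else n - 1 - (t - k))" if "t \<in> {1..n}" for t
        using PiE_mem[OF 2(2) that] by (auto split: if_splits)
      then show ?thesis using that[of k] 2 by (auto simp: PiE_iff)
    qed
    then show "p \<in> standard_exps n (S3 n)"
      unfolding standard_exps_S3[OF n] by blast
  qed
  have std: "standard_exps n (S3 n) \<subseteq> PF3 n"
  proof
    fix p assume p: "p \<in> standard_exps n (S3 n)"
    then have "p \<in> PF n"
      using standard_exps_subset_PF[of "S3 n" n] S_permutes(3) by blast
    obtain k where k: "k \<in> {1..n}"
      and le: "\<And>t. t \<in> {1..n} \<Longrightarrow> p t \<le> (if t < k then t - 1 else n - 1 - (t - k))"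
      using p unfolding standard_exps_S3[OF n] by blast
    have "p j < n - (j - i)" if "i \<in> {1..n}" "i \<le> p i" "j \<in> {i+1..n}" for i j
    proof -
      \<comment> \<open>Excedances may occur at several positions from \<open>k\<close> on. Since
        \<open>j - k \<ge> j - i\<close>, the bound \<open>n - 1 - (j - k)\<close> is below
        \<open>n - (j - i)\<close>.\<close>
      have "k \<le> i" using le[OF that(1)] that(1,2) by (auto split: if_splits)
      then show ?thesis using le[of j] that k by auto
    qed
    then show "p \<in> PF3 n"
      using \<open>p \<in> PF n\<close> unfolding PF3_def by blast
  qed
  have PF: "PF3 n \<subseteq> ?A \<union> ?B"
  proof
    fix p assume p: "p \<in> PF3 n"
    then have PF: "p \<in> PF n" by (simp add: PF3_def)
    show "p \<in> ?A \<union> ?B"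
    proof (rule first_excedance_split)
      show "p \<in> {1..n} \<rightarrow>\<^sub>E UNIV" using PF by (simp add: PF_def)
      show "p t < n" if "t \<in> {1..n}" for t using PF_less[OF PF that] .
      show "p j < n - (j - i)" if "i \<in> {1..n}" "i \<le> p i" "j \<in> {i+1..n}" for i j
        using p that unfolding PF3_def by blast
    qed
  qed
  show "PF3 n = standard_exps n (S3 n)"
    by (rule equalityI[OF subset_trans[OF PF boxes] std])
  show "PF3 n = ?A \<union> ?B"
    by (rule equalityI[OF PF subset_trans[OF boxes std]])
qed

lemma card_PF1: "n \<ge> 1 \<Longrightarrow> 2 * card (PF1 n) = fact (n + 1)"
  by (simp only: PF1_eq(2) card_last_zero_boxes)

lemma card_PF2:
  assumes "n \<ge> 1"
  shows "2 * card (PF2 n) = fact (n + 1)"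
  unfolding PF2_eq(2)[OF assms] by (rule card_first_excedance_boxes[OF assms refl])

lemma card_PF3:
  assumes "n \<ge> 1"
  shows "2 * card (PF3 n) = fact (n + 1)"
  unfolding PF3_eq(2)[OF assms]
proof (rule card_first_excedance_boxes[OF assms])
  fix k assume k: "k \<in> {1..n}"
  show "(\<Prod>t\<in>{k<..n}. n - (t - k)) = (\<Prod>t\<in>{k<..n}. t - 1)"
    \<comment> \<open>Reversing \<open>{k<..n}\<close> by \<open>t \<mapsto> n + k + 1 - t\<close>
      turns the factor \<open>n - (t - k)\<close> into \<open>t - 1\<close>.\<close>
    using k by (intro prod.reindex_bij_witness[of _ "\<lambda>t. n + k + 1 - t" "\<lambda>t. n + k + 1 - t"]) auto
qed

theorem theorem3:
  fixes n :: nat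
  assumes "n \<ge> 1"
    and "(S, P) \<in> {(S1 n, PF1 n), (S2 n, PF2 n), (S3 n, PF3 n)}"
  shows "has_quot_dim n (alexander_dual n (\<lambda>_. n) (perm_ideal n S) :: 'k::field mpoly set) (card P)
    \<and> real (card P) = fact (n + 1) / 2"
proof
  have P: "P = standard_exps n S"
    using assms PF1_eq(1) PF2_eq(1) PF3_eq(1) by auto
  have perm: "\<sigma> permutes {1..n}" if "\<sigma> \<in> S" for \<sigma>
    using assms(2) that S_permutes by auto
  show "has_quot_dim n (alexander_dual n (\<lambda>_. n) (perm_ideal n S) :: 'k mpoly set) (card P)"
    unfolding P by (rule has_quot_dim_alexander_dual) (rule perm)
  have "2 * card P = fact (n + 1)"
    using assms card_PF1 card_PF2 card_PF3 by auto
  then have "real (2 * card P) = fact (n + 1)"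
    by (simp only: of_nat_fact)
  then show "real (card P) = fact (n + 1) / 2"
    by simp
qed

end
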